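(* Suppose that the triangular array $\{x_{i,n}\}_{1\le i\le n}$ satisfies the UPDC condition and the short-range dependence condition with exponent $\tau>1$ (both defined in the context). Then there exists a constant $C>0$ such that, for all sufficiently large $n$, $$\max_{i>j}|\phi_{ij,n}|\le C\Big(\frac{\log j+1}{j}\Big)^{\tau-1}\qquad\text{for all } j\ge 1,$$ where the maximum is over $j<i\le n$. Moreover, let $b=b(n)$ be the order of approximation, and for $i>b$ let $\phi^b_{i0,n},\dots,\phi^b_{ib,n}$ be the coefficients of the best linear forecast of $x_{i,n}$ based on $x_{i-1,n},\dots,x_{i-b,n}$, and set $$\boldsymbol{\phi}_{i,n}=(\phi_{i1,n},\dots,\phi_{i,i-1,n})^*,\qquad \boldsymbol{\phi}^b_{i,n}=(\phi^b_{i1,n},\dots,\phi^b_{ib,n},\mathbf 0)^*\in\mathbb{R}^{i-1}.$$ If $\tau>2$, then there is a constant $C>0$ such that, for all sufficiently large $n$, $$\max_{i>b}\big|\boldsymbol{\phi}_{i,n}-\boldsymbol{\phi}^b_{i,n}\big|\le C(\log b)^{\tau-1}b^{-(\tau-1)},\qquad \max_{i>b}\big|\phi_{i0,n}-\phi^b_{i0,n}\big|\le C(\log b)^{\tau}b^{-(\tau-2)}.$$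
   Context: For each $n$, $x_{1,n},\dots,x_{n,n}$ are real random variables. $|\cdot|$ is the Euclidean norm, $^*$ is transpose, and constants $C$ do not depend on $n$. UPDC condition: there is a universal constant $\kappa>0$ such that for all sufficiently large $n$ the smallest eigenvalue of the covariance matrix $\operatorname{Cov}(x_{1,n},\dots,x_{n,n})$ is at least $\kappa$. Short-range dependence condition with exponent $\tau>1$: there is a constant $C>0$ independent of $n$ with $|\operatorname{Cov}(x_{k,n},x_{k+r,n})|\le C|r|^{-\tau}$ for all $n$, $1\le k\le n$, $-k+1\le r\le n-k$, $r\ne0$; also $\sup_{i,n}\operatorname{Var}(x_{i,n})<\infty$ and $\sup_{i,n}\mathbb{E}|x_{i,n}|<\infty$. The best linear prediction (in mean squared error, with intercept) of $x_{i,n}$ from all its predecessors is $\widehat x_{i,n}=\phi_{i0,n}+\sum_{j=1}^{i-1}\phi_{ij,n}x_{i-j,n}$; this defines $\phi_{ij,n}$. Similarly $\phi^b_{i0,n}+\sum_{j=1}^b\phi^b_{ij,n}x_{i-j,n}$ is the best linear prediction of $x_{i,n}$ from $x_{i-1,n},\dots,x_{i-b,n}$. The order $b=b(n)$ is a sequence of positive integers, $b<n$, diverging to infinity with $n$. *)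

theory Defs
  imports "HOL-Probability.Probability" "Jordan_Normal_Form.Spectral_Radius"
begin

text \<open>
  A triangular array is a function x with x n i (for i in {1..n}) a real random variable on
  the probability space M n; the values of x n i for other i are irrelevant.
\<close>

definition covariance :: "'a measure \<Rightarrow> ('a \<Rightarrow> real) \<Rightarrow> ('a \<Rightarrow> real) \<Rightarrow> real" where
  "covariance M X Y = prob_space.expectation M (\<lambda>w. (X w - prob_space.expectation M X) * (Y w - prob_space.expectation M Y))"

text \<open>Matrix indices start at 0, indices of the random variables at 1.\<close>

definition covariance_matrix :: "'a measure \<Rightarrow> (nat \<Rightarrow> 'a \<Rightarrow> real) \<Rightarrow> nat \<Rightarrow> real mat" where
  "covariance_matrix M X n = mat n n (\<lambda>(i, j). covariance M (X (Suc i)) (X (Suc j)))"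

definition triangular_array :: "(nat \<Rightarrow> 'a measure) \<Rightarrow> (nat \<Rightarrow> nat \<Rightarrow> 'a \<Rightarrow> real) \<Rightarrow> bool" where
  "triangular_array M x \<longleftrightarrow>
     (\<forall>n. prob_space (M n) \<and> (\<forall>i\<in>{1..n}. x n i \<in> borel_measurable (M n)))"

text \<open>The spectrum is finite, and nonempty for n > 0 since the covariance matrix is real symmetric.\<close>

definition UPDC :: "(nat \<Rightarrow> 'a measure) \<Rightarrow> (nat \<Rightarrow> nat \<Rightarrow> 'a \<Rightarrow> real) \<Rightarrow> bool" where
  "UPDC M x \<longleftrightarrow>
     (\<exists>\<kappa>>0. \<forall>\<^sub>F n in sequentially. Min (spectrum (covariance_matrix (M n) (x n) n)) \<ge> \<kappa>)"

text \<open>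
  Square integrability is part of the finiteness of the variances; it has to be explicit because
  the Bochner integral of a non-integrable function is 0.
\<close>

definition short_range_dependent ::
    "(nat \<Rightarrow> 'a measure) \<Rightarrow> (nat \<Rightarrow> nat \<Rightarrow> 'a \<Rightarrow> real) \<Rightarrow> real \<Rightarrow> bool" where
  "short_range_dependent M x \<tau> \<longleftrightarrow>
     (\<forall>n. \<forall>i\<in>{1..n}. integrable (M n) (\<lambda>w. (x n i w)\<^sup>2)) \<and>
     (\<exists>C>0. \<forall>n. \<forall>k\<in>{1..n}. \<forall>r\<in>{- int k + 1..int n - int k}. r \<noteq> 0 \<longrightarrow>
        \<bar>covariance (M n) (x n k) (x n (nat (int k + r)))\<bar> \<le> C * real_of_int \<bar>r\<bar> powr (- \<tau>)) \<and>
     (\<exists>K. \<forall>n. \<forall>i\<in>{1..n}. prob_space.variance (M n) (x n i) \<le> K) \<and>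
     (\<exists>K. \<forall>n. \<forall>i\<in>{1..n}. prob_space.expectation (M n) (\<lambda>w. \<bar>x n i w\<bar>) \<le> K)"

definition linear_forecast ::
    "(nat \<Rightarrow> 'a \<Rightarrow> real) \<Rightarrow> nat \<Rightarrow> nat \<Rightarrow> (nat \<Rightarrow> real) \<Rightarrow> 'a \<Rightarrow> real" where
  "linear_forecast X i k c w = c 0 + (\<Sum>j = 1..k. c j * X (i - j) w)"

text \<open>
  c is a coefficient sequence (intercept c 0) of the best linear prediction of X i from
  X (i - 1), ..., X (i - k); only c 0, ..., c k matter.
\<close>

definition best_linear_prediction ::
    "'a measure \<Rightarrow> (nat \<Rightarrow> 'a \<Rightarrow> real) \<Rightarrow> nat \<Rightarrow> nat \<Rightarrow> (nat \<Rightarrow> real) \<Rightarrow> bool" where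
  "best_linear_prediction M X i k c \<longleftrightarrow>
     is_arg_min (\<lambda>d. prob_space.expectation M (\<lambda>w. (X i w - linear_forecast X i k d w)\<^sup>2)) (\<lambda>_. True) c"

end

theory Submission
  imports Defs
begin

text \<open>
  The coefficients of the best linear prediction solve normal equations \<open>a v = g\<close> whose matrix
  is coercive (UPDC) and whose entries decay like \<open>\<bar>i - l\<bar> powr - \<tau>\<close>. For a small step \<open>t\<close>
  the matrix \<open>I - t a\<close> is a contraction, so the fixed-point equation \<open>v = (I - t a) v + t g\<close> shows
  that the Euclidean norm of the part of \<open>v\<close> beyond \<open>p + m\<close> is at most \<open>\<rho> < 1\<close> times that of the part beyond
  \<open>p\<close>, up to an error of order \<open>m powr (1 - \<tau>)\<close>. Iterating this of the order of \<open>ln j\<close> times with \<open>m\<close> of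
  the order of \<open>j / ln j\<close> bounds the tail of \<open>v\<close> beyond \<open>j\<close>, hence \<open>v j\<close>. The coefficients of
  the order \<open>b\<close> forecast are the Galerkin approximation of \<open>v\<close> on the first \<open>b\<close> coordinates, so by
  Cea's lemma their distance to \<open>v\<close> is controlled by the tail of \<open>v\<close> beyond \<open>b\<close>.
\<close>

section \<open>Matrices with polynomial off-diagonal decay\<close>

text \<open>Comparison with an integral: by the mean value theorem each term times
  \<open>s - 1\<close> is at most a difference of consecutive values of
  \<open>r powr (1 - s)\<close>, and these differences telescope.\<close>

lemma sum_powr_tail_le:
  fixes s :: real
  assumes "s > 1" and "m \<ge> 1"
  shows "(\<Sum>r\<in>{m..<k}. real (r + 1) powr - s) \<le> real m powr (1 - s) / (s - 1)"
proof -
  have telescope: "(s - 1) * real (r + 1) powr - s \<le> real r powr (1 - s) - real (r + 1) powr (1 - s)"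
    if "r \<ge> 1" for r
  proof -
    have "\<exists>z. real r < z \<and> z < real (r + 1) \<and>
      real (r + 1) powr (1 - s) - real r powr (1 - s) = (real (r + 1) - real r) * ((1 - s) * z powr (1 - s - 1))"
      by (rule MVT2, simp, rule has_real_derivative_powr) (use that in simp)
    then obtain z where z: "real r < z" "z < real (r + 1)"
      "real (r + 1) powr (1 - s) - real r powr (1 - s) = (real (r + 1) - real r) * ((1 - s) * z powr (1 - s - 1))"
      by blast
    have "real (r + 1) powr - s \<le> z powr - s"
      using z that assms by (intro powr_mono2') auto
    then have "(s - 1) * real (r + 1) powr - s \<le> (s - 1) * z powr - s"
      using assms by (intro mult_left_mono) auto
    then show ?thesis using z(3) by (simp add: algebra_simps)
  qed
  have "(s - 1) * (\<Sum>r\<in>{m..<k}. real (r + 1) powr - s) \<le> real m powr (1 - s)"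
  proof (cases "k \<ge> m")
    case True
    then have "(s - 1) * (\<Sum>r\<in>{m..<k}. real (r + 1) powr - s) \<le> real m powr (1 - s) - real k powr (1 - s)"
    proof (induction k rule: dec_induct)
      case (step k)
      have "(s - 1) * (\<Sum>r\<in>{m..<Suc k}. real (r + 1) powr - s) =
          (s - 1) * (\<Sum>r\<in>{m..<k}. real (r + 1) powr - s) + (s - 1) * real (k + 1) powr - s"
        using \<open>m \<le> k\<close> by (simp add: algebra_simps)
      then show ?case using step.IH telescope[of k] \<open>m \<le> k\<close> \<open>m \<ge> 1\<close> by simp
    qed simp
    then show ?thesis using powr_ge_zero[of "real k" "1 - s"] by linarith
  qed simp
  then show ?thesis using \<open>s > 1\<close> by (simp add: field_simps)
qed

text \<open>Cauchy-Schwarz with the weights \<open>\<bar>a i l\<bar>\<close> split evenly between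
  both factors; the row sums bound one factor, the column sums enter after exchanging the order of
  summation.\<close>

lemma Schur_test:
  fixes a :: "'a \<Rightarrow> 'b \<Rightarrow> real"
  assumes "finite A" "finite B" "R \<ge> 0"
    and row: "\<And>i. i \<in> A \<Longrightarrow> (\<Sum>l\<in>B. \<bar>a i l\<bar>) \<le> R"
    and col: "\<And>l. l \<in> B \<Longrightarrow> (\<Sum>i\<in>A. \<bar>a i l\<bar>) \<le> R"
  shows "L2_set (\<lambda>i. \<Sum>l\<in>B. a i l * u l) A \<le> R * L2_set u B"
proof -
  have "(\<Sum>l\<in>B. a i l * u l)\<^sup>2 \<le> R * (\<Sum>l\<in>B. \<bar>a i l\<bar> * (u l)\<^sup>2)" if "i \<in> A" for i
  proof -
    have "\<bar>\<Sum>l\<in>B. a i l * u l\<bar> \<le> (\<Sum>l\<in>B. sqrt \<bar>a i l\<bar> * (sqrt \<bar>a i l\<bar> * \<bar>u l\<bar>))"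
      by (rule order_trans[OF sum_abs]) (simp add: abs_mult mult.assoc[symmetric])
    then have "(\<Sum>l\<in>B. a i l * u l)\<^sup>2 \<le> (\<Sum>l\<in>B. sqrt \<bar>a i l\<bar> * (sqrt \<bar>a i l\<bar> * \<bar>u l\<bar>))\<^sup>2"
      by (simp add: abs_le_square_iff[symmetric])
    also have "\<dots> \<le> (\<Sum>l\<in>B. (sqrt \<bar>a i l\<bar>)\<^sup>2) * (\<Sum>l\<in>B. (sqrt \<bar>a i l\<bar> * \<bar>u l\<bar>)\<^sup>2)"
      by (rule Cauchy_Schwarz_ineq_sum)
    also have "\<dots> = (\<Sum>l\<in>B. \<bar>a i l\<bar>) * (\<Sum>l\<in>B. \<bar>a i l\<bar> * (u l)\<^sup>2)"
      by (simp add: power_mult_distrib)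
    also have "\<dots> \<le> R * (\<Sum>l\<in>B. \<bar>a i l\<bar> * (u l)\<^sup>2)"
      by (intro mult_right_mono row that sum_nonneg) auto
    finally show ?thesis .
  qed
  then have "(\<Sum>i\<in>A. (\<Sum>l\<in>B. a i l * u l)\<^sup>2) \<le> (\<Sum>i\<in>A. R * (\<Sum>l\<in>B. \<bar>a i l\<bar> * (u l)\<^sup>2))"
    by (rule sum_mono)
  also have "\<dots> = R * (\<Sum>l\<in>B. (\<Sum>i\<in>A. \<bar>a i l\<bar>) * (u l)\<^sup>2)"
    unfolding sum_distrib_left sum_distrib_right by (subst sum.swap) simp
  also have "\<dots> \<le> R * (\<Sum>l\<in>B. R * (u l)\<^sup>2)"
    using \<open>R \<ge> 0\<close> by (intro mult_left_mono sum_mono mult_right_mono col) auto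
  also have "\<dots> = (R * L2_set u B)\<^sup>2"
    by (simp add: L2_set_def power_mult_distrib sum_nonneg sum_distrib_left[symmetric] power2_eq_square)
  finally show ?thesis
    unfolding L2_set_def[of "\<lambda>i. \<Sum>l\<in>B. a i l * u l"]
    by (intro real_le_lsqrt) (use \<open>R \<ge> 0\<close> in \<open>auto intro: sum_nonneg\<close>)
qed

text \<open>With truncated subtraction, \<open>(i - l) + (l - i)\<close> is the distance of
  \<open>i\<close> and \<open>l\<close>. Every distance occurs at most once on each side of
  \<open>i\<close>, hence the factor 2.\<close>

lemma sum_dist_le:
  fixes h :: "nat \<Rightarrow> real"
  assumes "finite B" and h: "\<And>r. h r \<ge> 0" and S: "\<And>k. (\<Sum>r<k. h r) \<le> S"
  shows "(\<Sum>l\<in>B. h ((i - l) + (l - i))) \<le> 2 * S"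
proof -
  obtain k where k: "B \<subseteq> {..<k}"
    using \<open>finite B\<close> finite_nat_iff_bounded by blast
  have "(\<Sum>l\<in>B. h ((i - l) + (l - i))) \<le> (\<Sum>l\<in>{..i} \<union> {i..<k}. h ((i - l) + (l - i)))"
    using k by (intro sum_mono2) (auto simp: h)
  also have "\<dots> \<le> (\<Sum>l\<in>{..i}. h ((i - l) + (l - i))) + (\<Sum>l\<in>{i..<k}. h ((i - l) + (l - i)))"
    by (subst sum_Un) (auto intro!: mult_nonneg_nonneg sum_nonneg h)
  also have "(\<Sum>l\<in>{..i}. h ((i - l) + (l - i))) = (\<Sum>r<Suc i. h r)"
    by (rule sum.reindex_bij_witness[of _ "\<lambda>r. i - r" "\<lambda>l. i - l"]) auto
  also have "(\<Sum>l\<in>{i..<k}. h ((i - l) + (l - i))) = (\<Sum>r<k - i. h r)"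
    by (rule sum.reindex_bij_witness[of _ "\<lambda>r. r + i" "\<lambda>l. l - i"]) auto
  finally show ?thesis using S[of "Suc i"] S[of "k - i"] by linarith
qed

text \<open>Schur's test for a block whose row and column indices are at distance at least
  \<open>m\<close>. Later \<open>m = 0\<close> gives the norm of the whole matrix and
  \<open>m \<ge> 1\<close> the smallness of a block far from the diagonal.\<close>

lemma decaying_matrix_bound:
  fixes a :: "nat \<Rightarrow> nat \<Rightarrow> real"
  assumes "finite A" "finite B" "D \<ge> 0"
    and a: "\<And>i l. i \<in> A \<Longrightarrow> l \<in> B \<Longrightarrow> \<bar>a i l\<bar> \<le> D * real ((i - l) + (l - i) + 1) powr - \<tau>"
    and m: "\<And>i l. i \<in> A \<Longrightarrow> l \<in> B \<Longrightarrow> m \<le> (i - l) + (l - i)"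
    and S: "\<And>k. (\<Sum>r\<in>{m..<k}. real (r + 1) powr - \<tau>) \<le> S"
  shows "L2_set (\<lambda>i. \<Sum>l\<in>B. a i l * u l) A \<le> 2 * D * S * L2_set u B"
proof -
  define h where "h r = (if m \<le> r then D * real (r + 1) powr - \<tau> else 0)" for r
  have "S \<ge> 0" using S[of m] by simp
  have h0: "h r \<ge> 0" for r using \<open>D \<ge> 0\<close> by (simp add: h_def)
  have hs: "(\<Sum>r<k. h r) \<le> D * S" for k
  proof -
    have "(\<Sum>r<k. h r) = (\<Sum>r\<in>{m..<k}. D * real (r + 1) powr - \<tau>)"
      unfolding h_def by (subst sum.inter_filter[symmetric]) (auto intro!: sum.cong)
    also have "\<dots> \<le> D * S"
      using S[of k] \<open>D \<ge> 0\<close> by (subst sum_distrib_left[symmetric]) (rule mult_left_mono)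
    finally show ?thesis .
  qed
  have le: "\<bar>a i l\<bar> \<le> h ((i - l) + (l - i))" if "i \<in> A" "l \<in> B" for i l
    using a[OF that] m[OF that] by (simp add: h_def)
  have le': "\<bar>a i l\<bar> \<le> h ((l - i) + (i - l))" if "i \<in> A" "l \<in> B" for i l
    using le[OF that] by (simp add: add.commute)
  have "L2_set (\<lambda>i. \<Sum>l\<in>B. a i l * u l) A \<le> (2 * (D * S)) * L2_set u B"
  proof (rule Schur_test)
    show "(\<Sum>l\<in>B. \<bar>a i l\<bar>) \<le> 2 * (D * S)" if "i \<in> A" for i
    proof -
      have "(\<Sum>l\<in>B. \<bar>a i l\<bar>) \<le> (\<Sum>l\<in>B. h ((i - l) + (l - i)))"
        by (intro sum_mono le that)
      then show ?thesis using sum_dist_le[of B h "D * S" i] assms(2) h0 hs by fastforce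
    qed
    show "(\<Sum>i\<in>A. \<bar>a i l\<bar>) \<le> 2 * (D * S)" if "l \<in> B" for l
    proof -
      have "(\<Sum>i\<in>A. \<bar>a i l\<bar>) \<le> (\<Sum>i\<in>A. h ((l - i) + (i - l)))"
        by (intro sum_mono le' that)
      then show ?thesis using sum_dist_le[of A h "D * S" l] assms(1) h0 hs by fastforce
    qed
  qed (use assms \<open>S \<ge> 0\<close> in auto)
  then show ?thesis by (simp add: mult.assoc)
qed

lemma sum_powr_le:
  fixes s :: real
  assumes "s > 1"
  shows "(\<Sum>r\<in>{0..<k}. real (r + 1) powr - s) \<le> s / (s - 1)"
proof (cases "k = 0")
  case False
  then have "(\<Sum>r\<in>{0..<k}. real (r + 1) powr - s) = 1 + (\<Sum>r\<in>{1..<k}. real (r + 1) powr - s)"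
    by (subst sum.atLeast_Suc_lessThan) auto
  also have "\<dots> \<le> 1 + real 1 powr (1 - s) / (s - 1)"
    using assms by (intro add_left_mono sum_powr_tail_le) auto
  finally show ?thesis using assms by (simp add: field_simps)
qed (use assms in simp)

text \<open>The normal equations with the probability stripped off: indices are lags,
  \<open>a\<close> stands for the covariances of the predictors and \<open>g\<close> for those with
  the target. All constants defined below depend on \<open>\<tau>\<close>, \<open>D\<close> and
  \<open>\<kappa>\<close> only, hence are uniform in \<open>N\<close>.\<close>

locale decaying_system =
  fixes \<tau> D \<kappa> :: real and N :: nat
    and a :: "nat \<Rightarrow> nat \<Rightarrow> real" and g v :: "nat \<Rightarrow> real"
  assumes tau: "\<tau> > 1" and kappa: "0 < \<kappa>" "\<kappa> \<le> D"
    and a_decay: "\<And>i l. i \<in> {1..N} \<Longrightarrow> l \<in> {1..N} \<Longrightarrow> \<bar>a i l\<bar> \<le> D * real ((i - l) + (l - i) + 1) powr - \<tau>"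
    and g_decay: "\<And>i. i \<in> {1..N} \<Longrightarrow> \<bar>g i\<bar> \<le> D * real (i + 1) powr - \<tau>"
    and coercive: "\<And>u. \<kappa> * (\<Sum>i=1..N. (u i)\<^sup>2) \<le> (\<Sum>i=1..N. u i * (\<Sum>l=1..N. a i l * u l))"
    and solution: "\<And>i. i \<in> {1..N} \<Longrightarrow> (\<Sum>l=1..N. a i l * v l) = g i"
begin

section \<open>Norm bounds and the contraction\<close>

definition L where "L = 2 * D * (\<tau> / (\<tau> - 1))"

text \<open>The square of \<open>\<rho>\<close> is the minimum of
  \<open>1 - 2 * t * \<kappa> + t\<^sup>2 * L\<^sup>2\<close> over \<open>t\<close>, attained at
  \<open>t = \<kappa> / L\<^sup>2\<close>.\<close>

definition \<rho> where "\<rho> = sqrt (1 - \<kappa>\<^sup>2 / L\<^sup>2)"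

definition B where "B = D * (\<tau> / (\<tau> - 1)) / \<kappa>"

lemma D_pos: "D > 0" using kappa by simp

lemma L_gt: "L > \<kappa>"
proof -
  have "D * 1 < D * (2 * (\<tau> / (\<tau> - 1)))"
    using tau D_pos by (intro mult_strict_left_mono) (auto simp: field_simps)
  then show ?thesis using kappa by (simp add: L_def mult.left_commute mult.assoc)
qed

lemma rho: "0 < \<rho>" "\<rho> < 1"
proof -
  have "\<kappa>\<^sup>2 < L\<^sup>2" using L_gt kappa by (intro power_strict_mono) auto
  then show "0 < \<rho>" "\<rho> < 1" using kappa L_gt by (auto simp: \<rho>_def field_simps)
qed

lemma B_nonneg: "B \<ge> 0" using D_pos tau kappa by (simp add: B_def)

lemma operator_bound:
  assumes "A \<subseteq> {1..N}"
  shows "L2_set (\<lambda>i. \<Sum>l=1..N. a i l * u l) A \<le> L * L2_set u {1..N}"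
  unfolding L_def
  by (rule decaying_matrix_bound[where m = 0 and \<tau> = \<tau>])
    (use assms a_decay sum_powr_le[OF tau] D_pos in \<open>auto intro: finite_subset[OF assms] simp: subset_iff\<close>)

text \<open>Testing the system with \<open>v\<close> itself: coercivity bounds
  \<open>\<kappa>\<close> times the squared norm of \<open>v\<close> by the product of the norms of
  \<open>v\<close> and \<open>g\<close>, and the norm of \<open>g\<close> is at most its absolute
  sum.\<close>

lemma norm_v_le: "L2_set v {1..N} \<le> B"
proof -
  have "L2_set g {1..N} \<le> (\<Sum>i=1..N. \<bar>g i\<bar>)" by (rule L2_set_le_sum_abs)
  also have "\<dots> \<le> (\<Sum>i=1..N. D * real (i + 1) powr - \<tau>)"
    by (intro sum_mono g_decay)
  also have "\<dots> \<le> (\<Sum>i\<in>{0..<Suc N}. D * real (i + 1) powr - \<tau>)"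
    using D_pos by (intro sum_mono2) auto
  also have "\<dots> = D * (\<Sum>i\<in>{0..<Suc N}. real (i + 1) powr - \<tau>)"
    by (rule sum_distrib_left[symmetric])
  also have "\<dots> \<le> D * (\<tau> / (\<tau> - 1))"
    using D_pos by (intro mult_left_mono sum_powr_le tau) auto
  finally have g: "L2_set g {1..N} \<le> D * (\<tau> / (\<tau> - 1))" .
  have "\<kappa> * (L2_set v {1..N})\<^sup>2 \<le> (\<Sum>i=1..N. v i * (\<Sum>l=1..N. a i l * v l))"
    using coercive[of v] by (simp add: L2_set_def sum_nonneg)
  also have "\<dots> = (\<Sum>i=1..N. v i * g i)"
    by (intro sum.cong refl) (simp only: solution)
  also have "\<dots> \<le> (\<Sum>i=1..N. \<bar>v i\<bar> * \<bar>g i\<bar>)"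
    by (intro sum_mono) (simp flip: abs_mult)
  also have "\<dots> \<le> L2_set v {1..N} * L2_set g {1..N}" by (rule L2_set_mult_ineq)
  also have "\<dots> \<le> L2_set v {1..N} * (D * (\<tau> / (\<tau> - 1)))"
    using g by (rule mult_left_mono) simp
  finally have "L2_set v {1..N} * (\<kappa> * L2_set v {1..N}) \<le> L2_set v {1..N} * (D * (\<tau> / (\<tau> - 1)))"
    by (simp add: power2_eq_square mult.left_commute)
  \<comment> \<open>The norm may be zero, so cancelling it leaves two cases.\<close>
  then have "L2_set v {1..N} = 0 \<or> \<kappa> * L2_set v {1..N} \<le> D * (\<tau> / (\<tau> - 1))"
    using L2_set_nonneg[of v "{1..N}"] by (metis mult_le_cancel_left_pos less_le)
  then have "L2_set v {1..N} = 0 \<or> L2_set v {1..N} \<le> B"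
    unfolding B_def using kappa by (subst pos_le_divide_eq) (auto simp: mult.commute)
  then show ?thesis using B_nonneg by auto
qed

text \<open>When the square is expanded, coercivity bounds the cross term from below and the
  operator norm bound \<open>L\<close> controls the quadratic term from above.\<close>

lemma contraction:
  "L2_set (\<lambda>i. u i - \<kappa> / L\<^sup>2 * (\<Sum>l=1..N. a i l * u l)) {1..N} \<le> \<rho> * L2_set u {1..N}"
proof -
  define w where "w i = (\<Sum>l=1..N. a i l * u l)" for i
  define t where "t = \<kappa> / L\<^sup>2"
  have "L > 0" using L_gt kappa by simp
  have "L2_set w {1..N} \<le> L * L2_set u {1..N}"
    unfolding w_def by (rule operator_bound) simp
  then have "(L2_set w {1..N})\<^sup>2 \<le> (L * L2_set u {1..N})\<^sup>2" by (rule power_mono) simp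
  then have w: "(\<Sum>i=1..N. (w i)\<^sup>2) \<le> L\<^sup>2 * (\<Sum>i=1..N. (u i)\<^sup>2)"
    by (simp add: L2_set_def power_mult_distrib sum_nonneg)
  have "(\<Sum>i=1..N. (u i - t * w i)\<^sup>2) =
      (\<Sum>i=1..N. (u i)\<^sup>2 - 2 * t * (u i * w i) + t\<^sup>2 * (w i)\<^sup>2)"
    by (intro sum.cong refl) (simp add: algebra_simps power2_eq_square)
  also have "\<dots> = (\<Sum>i=1..N. (u i)\<^sup>2) - 2 * t * (\<Sum>i=1..N. u i * w i) + t\<^sup>2 * (\<Sum>i=1..N. (w i)\<^sup>2)"
    by (simp only: sum.distrib sum_subtractf sum_distrib_left)
  also have "\<dots> \<le> (\<Sum>i=1..N. (u i)\<^sup>2) - 2 * t * (\<kappa> * (\<Sum>i=1..N. (u i)\<^sup>2)) + t\<^sup>2 * (L\<^sup>2 * (\<Sum>i=1..N. (u i)\<^sup>2))"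
    using w coercive[of u] kappa \<open>L > 0\<close>
    by (intro add_mono diff_mono mult_left_mono) (auto simp: t_def w_def)
  also have "\<dots> = (1 - \<kappa>\<^sup>2 / L\<^sup>2) * (\<Sum>i=1..N. (u i)\<^sup>2)"
    using \<open>L > 0\<close> by (simp add: t_def field_simps power2_eq_square)
  finally have "sqrt (\<Sum>i=1..N. (u i - t * w i)\<^sup>2) \<le> sqrt ((1 - \<kappa>\<^sup>2 / L\<^sup>2) * (\<Sum>i=1..N. (u i)\<^sup>2))"
    by (rule real_sqrt_le_mono)
  then show ?thesis by (simp add: L2_set_def real_sqrt_mult \<rho>_def t_def w_def)
qed

text \<open>Error of one step of the recursion, up to the factor
  \<open>real m powr (1 - \<tau>)\<close>: the first summand stems from the far block of
  \<open>a\<close> acting on \<open>v\<close>, the second from the part of \<open>g\<close> beyond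
  \<open>m\<close>.\<close>

definition E where "E = \<kappa> / L\<^sup>2 * (2 * D / (\<tau> - 1) * B + D / (\<tau> - 1))"

lemma E_nonneg: "E \<ge> 0"
  using kappa D_pos tau B_nonneg by (simp add: E_def)

section \<open>Decay of the tails of the solution\<close>

definition tail where "tail p = L2_set v {p<..N}"

lemma tail_0: "tail 0 \<le> B"
proof -
  have "{0<..N} = {1..N}" by auto
  then show ?thesis using norm_v_le by (simp add: tail_def)
qed

lemma tail_antimono: "p \<le> q \<Longrightarrow> tail q \<le> tail p"
  unfolding tail_def L2_set_def by (intro real_sqrt_le_mono sum_mono2) auto

text \<open>The fixed-point equation \<open>v = (I - t a) v + t g\<close>, restricted to the indices beyond \<open>p + m\<close>:
  the entries of \<open>v\<close> beyond \<open>p\<close> are contracted, the others only contribute through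
  entries of \<open>a\<close> at distance at least \<open>m\<close> from the diagonal.\<close>

lemma tail_recursion:
  assumes "m \<ge> 1"
  shows "tail (p + m) \<le> \<rho> * tail p + E * real m powr (1 - \<tau>)"
proof -
  define t where "t = \<kappa> / L\<^sup>2"
  have "t \<ge> 0" using kappa by (simp add: t_def)
  define u where "u i = (if p < i then v i else 0)" for i
  define A where "A = {p + m<..N}"
  define P where "P = {1..min p N}"
  define \<delta> where "\<delta> = real m powr (1 - \<tau>) / (\<tau> - 1)"
  have A: "A \<subseteq> {1..N}" by (auto simp: A_def)
  \<comment> \<open>\<open>u\<close> carries the entries of \<open>v\<close> beyond
    \<open>p\<close>, and \<open>P\<close> indexes the remaining ones. On \<open>A\<close> the
    cutoff does not change \<open>v\<close>, so the fixed-point equation can be written with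
    \<open>u\<close>.\<close>
  have split: "v i = (u i - t * (\<Sum>l=1..N. a i l * u l)) + (- t) * (\<Sum>l\<in>P. a i l * v l) + t * g i"
    if "i \<in> A" for i
  proof -
    have "(\<Sum>l=1..N. a i l * v l) = (\<Sum>l=1..N. a i l * u l) + (\<Sum>l=1..N. a i l * (if l \<le> p then v l else 0))"
      unfolding sum.distrib[symmetric] by (rule sum.cong) (auto simp: u_def)
    also have "(\<Sum>l=1..N. a i l * (if l \<le> p then v l else 0)) = (\<Sum>l\<in>P. a i l * v l)"
      by (rule sum.mono_neutral_cong_right) (auto simp: P_def)
    finally have "g i = (\<Sum>l=1..N. a i l * u l) + (\<Sum>l\<in>P. a i l * v l)"
      using solution[of i] that A by auto
    moreover have "u i = v i" using that by (auto simp: A_def u_def)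
    ultimately show ?thesis by (simp add: algebra_simps)
  qed
  have "tail (p + m) = L2_set (\<lambda>i. (u i - t * (\<Sum>l=1..N. a i l * u l)) + (- t) * (\<Sum>l\<in>P. a i l * v l) + t * g i) A"
    unfolding tail_def A_def[symmetric] by (rule L2_set_cong) (use split in auto)
  also have "\<dots> \<le> L2_set (\<lambda>i. u i - t * (\<Sum>l=1..N. a i l * u l)) A +
      L2_set (\<lambda>i. (- t) * (\<Sum>l\<in>P. a i l * v l)) A + L2_set (\<lambda>i. t * g i) A"
    by (rule order_trans[OF L2_set_triangle_ineq add_right_mono[OF L2_set_triangle_ineq]])
  also have "\<dots> \<le> \<rho> * tail p + t * (2 * D * \<delta> * B) + t * (D * \<delta>)"
  proof (intro add_mono)
    have "L2_set (\<lambda>i. u i - t * (\<Sum>l=1..N. a i l * u l)) A \<le> L2_set (\<lambda>i. u i - t * (\<Sum>l=1..N. a i l * u l)) {1..N}"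
      unfolding L2_set_def using A by (intro real_sqrt_le_mono sum_mono2) auto
    also have "\<dots> \<le> \<rho> * L2_set u {1..N}" unfolding t_def by (rule contraction)
    also have "L2_set u {1..N} = tail p"
      unfolding tail_def L2_set_def u_def
      by (rule arg_cong[where f = sqrt], rule sum.mono_neutral_cong_right) auto
    finally show "L2_set (\<lambda>i. u i - t * (\<Sum>l=1..N. a i l * u l)) A \<le> \<rho> * tail p" .
    \<comment> \<open>Indices in \<open>A\<close> exceed those in \<open>P\<close> by more than
      \<open>m\<close>, so only entries of \<open>a\<close> far from the diagonal occur.\<close>
    have "L2_set (\<lambda>i. \<Sum>l\<in>P. a i l * v l) A \<le> 2 * D * \<delta> * L2_set v P"
    proof (rule decaying_matrix_bound[where m = m and \<tau> = \<tau>])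
      show "(\<Sum>r\<in>{m..<k}. real (r + 1) powr - \<tau>) \<le> \<delta>" for k
        unfolding \<delta>_def by (rule sum_powr_tail_le[OF tau \<open>m \<ge> 1\<close>])
      show "\<bar>a i l\<bar> \<le> D * real ((i - l) + (l - i) + 1) powr - \<tau>" if "i \<in> A" "l \<in> P" for i l
        by (rule a_decay) (use that in \<open>auto simp: A_def P_def\<close>)
    qed (use D_pos in \<open>auto simp: A_def P_def\<close>)
    also have "\<dots> \<le> 2 * D * \<delta> * B"
    proof (rule mult_left_mono)
      have "L2_set v P \<le> L2_set v {1..N}"
        unfolding L2_set_def by (intro real_sqrt_le_mono sum_mono2) (auto simp: P_def)
      then show "L2_set v P \<le> B" using norm_v_le by simp
    qed (use D_pos tau in \<open>auto simp: \<delta>_def\<close>)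
    finally show "L2_set (\<lambda>i. (- t) * (\<Sum>l\<in>P. a i l * v l)) A \<le> t * (2 * D * \<delta> * B)"
      using \<open>t \<ge> 0\<close>
      by (simp add: L2_set_right_distrib[symmetric] mult_left_mono del: mult_minus_left)
        (simp add: L2_set_def power_mult_distrib sum_distrib_left[symmetric] real_sqrt_mult mult_left_mono)
    have "L2_set g A \<le> (\<Sum>i\<in>A. \<bar>g i\<bar>)" by (rule L2_set_le_sum_abs)
    also have "\<dots> \<le> (\<Sum>i\<in>A. D * real (i + 1) powr - \<tau>)"
      using A by (intro sum_mono g_decay) auto
    also have "\<dots> \<le> (\<Sum>i\<in>{m..<Suc N}. D * real (i + 1) powr - \<tau>)"
      using D_pos by (intro sum_mono2) (auto simp: A_def)
    also have "\<dots> = D * (\<Sum>i\<in>{m..<Suc N}. real (i + 1) powr - \<tau>)"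
      by (rule sum_distrib_left[symmetric])
    also have "\<dots> \<le> D * \<delta>"
      unfolding \<delta>_def using D_pos by (intro mult_left_mono sum_powr_tail_le tau \<open>m \<ge> 1\<close>) auto
    finally show "L2_set (\<lambda>i. t * g i) A \<le> t * (D * \<delta>)"
      using \<open>t \<ge> 0\<close> by (simp add: L2_set_right_distrib[symmetric] mult_left_mono)
  qed
  also have "\<dots> = \<rho> * tail p + E * real m powr (1 - \<tau>)"
    by (simp add: E_def t_def \<delta>_def algebra_simps add_divide_distrib)
  finally show ?thesis .
qed

text \<open>The errors are dominated by a geometric series; \<open>E / (1 - \<rho>)\<close> is the
  fixed point of \<open>y = \<rho> * y + E\<close>.\<close>

lemma tail_iterate:
  assumes "m \<ge> 1"
  shows "tail (k * m) \<le> \<rho> ^ k * B + E / (1 - \<rho>) * real m powr (1 - \<tau>)"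
proof (induction k)
  case 0
  have "0 \<le> E / (1 - \<rho>) * real m powr (1 - \<tau>)"
    using E_nonneg rho by (intro mult_nonneg_nonneg) auto
  then show ?case using tail_0 by simp
next
  case (Suc k)
  have "tail (Suc k * m) \<le> \<rho> * tail (k * m) + E * real m powr (1 - \<tau>)"
    using tail_recursion[OF assms, of "k * m"] by (simp add: add.commute)
  also have "\<dots> \<le> \<rho> * (\<rho> ^ k * B + E / (1 - \<rho>) * real m powr (1 - \<tau>)) + E * real m powr (1 - \<tau>)"
    using rho by (intro add_right_mono mult_left_mono Suc.IH) auto
  also have "\<dots> = \<rho> ^ Suc k * B + E / (1 - \<rho>) * real m powr (1 - \<tau>)"
    using rho by (simp add: field_simps)
  finally show ?case .
qed

text \<open>The factor in the bound \<open>c * (ln j + 1)\<close> on the number of steps; the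
  summand 2 absorbs the rounding up and the one extra step.\<close>

definition c where "c = 2 + (\<tau> - 1) / - ln \<rho>"

lemma c_gt: "c > 2" using rho tau by (simp add: c_def divide_pos_neg)

definition C where "C = (B + E / (1 - \<rho>)) * (2 * c) powr (\<tau> - 1)"

text \<open>The number of steps \<open>k\<close> is chosen so that \<open>\<rho> ^ k \<le> j powr (1 - \<tau>)\<close>.\<close>

lemma tail_le:
  assumes "j \<ge> 1"
  shows "tail (j - 1) \<le> C * ((ln (real j) + 1) / real j) powr (\<tau> - 1)"
proof -
  define l where "l = ln (real j) + 1"
  have l: "l \<ge> 1" using assms by (simp add: l_def)
  \<comment> \<open>The added 1 keeps \<open>k\<close> positive, also for \<open>j = 1\<close>, so
    that \<open>k\<close> steps of length \<open>m\<close> can be fitted into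
    \<open>j - 1\<close>.\<close>
  define k where "k = nat \<lceil>(\<tau> - 1) / - ln \<rho> * ln (real j)\<rceil> + 1"
  have nn: "(\<tau> - 1) / - ln \<rho> * ln (real j) \<ge> 0"
    using rho tau assms by (intro mult_nonneg_nonneg) (auto simp: divide_nonneg_neg)
  have k1: "real k \<ge> (\<tau> - 1) / - ln \<rho> * ln (real j)" "k \<ge> 1"
    unfolding k_def by linarith+
  have "real k \<le> (\<tau> - 1) / - ln \<rho> * ln (real j) + 2"
    unfolding k_def using nn by linarith
  also have "\<dots> \<le> c * l"
  proof -
    define q where "q = (\<tau> - 1) / - ln \<rho>"
    have "q \<ge> 0" using c_gt by (simp add: c_def q_def)
    then show ?thesis
      using assms by (simp add: c_def l_def q_def[symmetric] algebra_simps del: divide_minus_right)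
  qed
  finally have k2: "real k \<le> c * l" .
  define m where "m = (j - 1) div k"
  have jm: "real j \<le> (real m + 1) * (c * l)"
  proof -
    have "j - 1 < (m + 1) * k"
      using k1 unfolding m_def by (simp add: dividend_less_div_times)
    then have "j \<le> (m + 1) * k" by linarith
    then have "real j \<le> real ((m + 1) * k)" by (rule of_nat_mono)
    also have "\<dots> = (real m + 1) * real k" by (simp add: algebra_simps)
    also have "\<dots> \<le> (real m + 1) * (c * l)"
      using k2 by (intro mult_left_mono) auto
    finally show ?thesis .
  qed
  show ?thesis
  proof (cases "m = 0")
    \<comment> \<open>Here \<open>j\<close> is at most of the order of \<open>ln j + 1\<close>, so
      the claimed bound is no smaller than \<open>B\<close> and the trivial bound on the tail
      suffices.\<close>
    case True
    then have "real j \<le> c * l" using jm by simp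
    also have "\<dots> \<le> 2 * (c * l)" using c_gt l by simp
    finally have "1 \<le> 2 * c * (l / real j)"
      using assms by simp
    then have "1 \<le> (2 * c * (l / real j)) powr (\<tau> - 1)"
      using tau by (simp add: ge_one_powr_ge_zero)
    also have "\<dots> = (2 * c) powr (\<tau> - 1) * (l / real j) powr (\<tau> - 1)"
      using c_gt l by (subst powr_mult) auto
    finally have 1: "1 \<le> (2 * c) powr (\<tau> - 1) * (l / real j) powr (\<tau> - 1)" .
    have "tail (j - 1) \<le> B"
      using tail_antimono[of 0 "j - 1"] tail_0 by simp
    also have "\<dots> \<le> (B + E / (1 - \<rho>)) * 1"
      using E_nonneg rho by simp
    also have "\<dots> \<le> (B + E / (1 - \<rho>)) * ((2 * c) powr (\<tau> - 1) * (l / real j) powr (\<tau> - 1))"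
      using E_nonneg rho B_nonneg by (intro mult_left_mono 1) auto
    finally show ?thesis by (simp add: C_def l_def mult.assoc)
  next
    case False
    then have m: "m \<ge> 1" by simp
    have "tail (j - 1) \<le> tail (k * m)"
      by (rule tail_antimono) (simp add: m_def)
    also have "\<dots> \<le> \<rho> ^ k * B + E / (1 - \<rho>) * real m powr (1 - \<tau>)"
      by (rule tail_iterate[OF m])
    also have "\<dots> \<le> ((2 * c) powr (\<tau> - 1) * (l / real j) powr (\<tau> - 1)) * B +
      E / (1 - \<rho>) * ((2 * c) powr (\<tau> - 1) * (l / real j) powr (\<tau> - 1))"
    proof (intro add_mono mult_right_mono mult_left_mono)
      have "\<rho> ^ k = exp (ln \<rho> * real k)"
        using rho by (metis exp_ln exp_of_nat2_mult)
      also have "\<dots> \<le> exp (ln \<rho> * ((\<tau> - 1) / - ln \<rho> * ln (real j)))"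
        unfolding exp_le_cancel_iff by (rule mult_left_mono_neg[OF k1(1)]) (use rho in simp)
      also have "\<dots> = (1 / real j) powr (\<tau> - 1)"
        using rho assms by (simp add: powr_def ln_div)
      also have "\<dots> \<le> (2 * c * (l / real j)) powr (\<tau> - 1)"
      proof (rule powr_mono2)
        have "1 * 1 \<le> 2 * c * l" using c_gt l by (intro mult_mono) auto
        then show "1 / real j \<le> 2 * c * (l / real j)" by (simp add: divide_right_mono)
      qed (use tau in auto)
      also have "\<dots> = (2 * c) powr (\<tau> - 1) * (l / real j) powr (\<tau> - 1)"
        using c_gt l by (subst powr_mult) auto
      finally show "\<rho> ^ k \<le> (2 * c) powr (\<tau> - 1) * (l / real j) powr (\<tau> - 1)" .
      \<comment> \<open>Uses \<open>m + 1 \<le> 2 * m\<close> for \<open>m \<ge> 1\<close>, the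
        origin of the factor 2 in \<open>C\<close>.\<close>
      have "real j \<le> (2 * real m) * (c * l)"
        by (rule order_trans[OF jm], rule mult_right_mono) (use m c_gt l in auto)
      then have "1 / real m \<le> 2 * c * (l / real j)"
        using m assms by (simp add: field_simps)
      then have "(1 / real m) powr (\<tau> - 1) \<le> (2 * c * (l / real j)) powr (\<tau> - 1)"
        using tau by (intro powr_mono2) auto
      also have "\<dots> = (2 * c) powr (\<tau> - 1) * (l / real j) powr (\<tau> - 1)"
        using c_gt l by (subst powr_mult) auto
      also have "(1 / real m) powr (\<tau> - 1) = real m powr (1 - \<tau>)"
        by (simp add: powr_divide powr_minus_divide[symmetric])
      finally show "real m powr (1 - \<tau>) \<le> (2 * c) powr (\<tau> - 1) * (l / real j) powr (\<tau> - 1)" .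
    qed (use B_nonneg E_nonneg rho in auto)
    finally show ?thesis by (simp add: C_def l_def algebra_simps)
  qed
qed

section \<open>Galerkin approximation\<close>

text \<open>Cea's lemma: \<open>w\<close> is the Galerkin approximation of \<open>v\<close> on the first \<open>b\<close> coordinates.\<close>

lemma galerkin_error:
  assumes "b \<le> N" and w0: "\<And>l. l > b \<Longrightarrow> w l = 0"
    and w: "\<And>i. i \<in> {1..b} \<Longrightarrow> (\<Sum>l=1..N. a i l * w l) = g i"
  shows "L2_set (\<lambda>i. v i - w i) {1..N} \<le> L / \<kappa> * tail b"
proof -
  define d where "d i = v i - w i" for i
  define r where "r i = (\<Sum>l=1..N. a i l * d l)" for i
  \<comment> \<open>Galerkin orthogonality: \<open>v\<close> and \<open>w\<close> satisfy the same
    first \<open>b\<close> equations.\<close>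
  have r0: "r i = 0" if "i \<in> {1..b}" for i
  proof -
    have "r i = (\<Sum>l=1..N. a i l * v l) - (\<Sum>l=1..N. a i l * w l)"
      unfolding r_def d_def by (simp add: sum_subtractf right_diff_distrib)
    then show ?thesis using that w[of i] solution[of i] \<open>b \<le> N\<close> by simp
  qed
  have "\<kappa> * (L2_set d {1..N})\<^sup>2 \<le> (\<Sum>i=1..N. d i * r i)"
    using coercive[of d] by (simp add: L2_set_def sum_nonneg r_def)
  \<comment> \<open>The first \<open>b\<close> residuals vanish, and beyond \<open>b\<close> the
    error \<open>d\<close> is \<open>v\<close> because \<open>w\<close> is zero there.\<close>
  also have "\<dots> = (\<Sum>i\<in>{b<..N}. v i * r i)"
    by (rule sum.mono_neutral_cong_right) (use r0 w0 in \<open>auto simp: d_def\<close>)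
  also have "\<dots> \<le> (\<Sum>i\<in>{b<..N}. \<bar>v i\<bar> * \<bar>r i\<bar>)"
    by (intro sum_mono) (simp flip: abs_mult)
  also have "\<dots> \<le> tail b * L2_set r {b<..N}"
    unfolding tail_def by (rule L2_set_mult_ineq)
  also have "\<dots> \<le> tail b * (L * L2_set d {1..N})"
    unfolding r_def by (intro mult_left_mono operator_bound) (auto simp: tail_def)
  finally have "L2_set d {1..N} * (\<kappa> * L2_set d {1..N}) \<le> L2_set d {1..N} * (L * tail b)"
    by (simp add: power2_eq_square mult.left_commute mult.commute)
  then have "L2_set d {1..N} = 0 \<or> \<kappa> * L2_set d {1..N} \<le> L * tail b"
    using L2_set_nonneg[of d "{1..N}"] by (metis mult_le_cancel_left_pos less_le)
  moreover have "0 \<le> L / \<kappa> * tail b"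
    using L_gt kappa by (simp add: tail_def)
  ultimately have "L2_set d {1..N} \<le> L / \<kappa> * tail b"
    using kappa by (auto simp: field_simps)
  then show ?thesis unfolding d_def .
qed

lemma coeff_le: "j \<in> {1..N} \<Longrightarrow> \<bar>v j\<bar> \<le> tail (j - 1)"
  using member_le_L2_set[of "{j - 1<..N}" j "\<lambda>l. \<bar>v l\<bar>"] by (simp add: tail_def L2_set_def)

lemma C_nonneg: "C \<ge> 0"
  using B_nonneg E_nonneg rho by (simp add: C_def)

definition G where "G = L / \<kappa> * (C * 2 powr (\<tau> - 1))"

lemma G_nonneg: "G \<ge> 0"
  using C_nonneg L_gt kappa by (simp add: G_def)

text \<open>Cea's lemma combined with the tail bound. The condition
  \<open>ln (real b) \<ge> 1\<close> allows replacing \<open>ln b + 1\<close> by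
  \<open>2 * ln b\<close>, which gives the factor \<open>2 powr (\<tau> - 1)\<close> in
  \<open>G\<close>.\<close>

lemma galerkin_error_le:
  assumes "b \<le> N" and "ln (real b) \<ge> 1" and w0: "\<And>l. l > b \<Longrightarrow> w l = 0"
    and w: "\<And>i. i \<in> {1..b} \<Longrightarrow> (\<Sum>l=1..N. a i l * w l) = g i"
  shows "L2_set (\<lambda>i. v i - w i) {1..N} \<le> G * ln (real b) powr (\<tau> - 1) * real b powr - (\<tau> - 1)"
proof -
  have b: "b \<ge> 1" using assms(2) by (cases b) auto
  have "tail b \<le> tail (b - 1)" by (rule tail_antimono) simp
  also have "\<dots> \<le> C * ((ln (real b) + 1) / real b) powr (\<tau> - 1)" by (rule tail_le[OF b])
  also have "\<dots> \<le> C * (2 * ln (real b) / real b) powr (\<tau> - 1)"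
    using assms(2) b tau C_nonneg by (intro mult_left_mono powr_mono2 divide_right_mono) auto
  also have "\<dots> = C * 2 powr (\<tau> - 1) * (ln (real b) powr (\<tau> - 1) * real b powr - (\<tau> - 1))"
  proof -
    have "(2 * ln (real b) / real b) powr (\<tau> - 1) =
        (2 * ln (real b)) powr (\<tau> - 1) / real b powr (\<tau> - 1)"
      by (rule powr_divide)
    also have "(2 * ln (real b)) powr (\<tau> - 1) = 2 powr (\<tau> - 1) * ln (real b) powr (\<tau> - 1)"
      by (rule powr_mult)
    finally show ?thesis by (simp only: powr_minus divide_inverse mult.assoc)
  qed
  finally have le: "L / \<kappa> * tail b \<le>
      L / \<kappa> * (C * 2 powr (\<tau> - 1) * (ln (real b) powr (\<tau> - 1) * real b powr - (\<tau> - 1)))"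
    using L_gt kappa by (intro mult_left_mono) auto
  have "L2_set (\<lambda>i. v i - w i) {1..N} \<le> L / \<kappa> * tail b"
    by (rule galerkin_error) (use assms in auto)
  also note le
  finally show ?thesis
    unfolding G_def by (simp only: mult.assoc)
qed

definition H where "H = C * (2 * (\<tau> - 1) / (\<tau> - 2) + 1) powr (\<tau> - 1)"

text \<open>A small power of \<open>j\<close> absorbs the logarithm in the tail bound. The exponent
  \<open>\<tau> / 2\<close> exceeds 1, so the bound is summable.\<close>

lemma coeff_le_powr:
  assumes "\<tau> > 2" and j: "j \<in> {1..N}"
  shows "\<bar>v j\<bar> \<le> H * real j powr - (\<tau> / 2)"
proof -
  \<comment> \<open>Chosen so that
    \<open>(\<delta> - 1) * (\<tau> - 1) = - (\<tau> / 2)\<close>.\<close>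
  define \<delta> where "\<delta> = (\<tau> - 2) / (2 * (\<tau> - 1))"
  have \<delta>: "\<delta> > 0" "1 / \<delta> = 2 * (\<tau> - 1) / (\<tau> - 2)" "\<delta> * (\<tau> - 1) = \<tau> / 2 - 1"
    using assms by (auto simp: \<delta>_def field_simps)
  have j1: "real j \<ge> 1" using j by simp
  have "\<delta> * ln (real j) = ln (real j powr \<delta>)" using j1 by (simp add: ln_powr)
  also have "\<dots> \<le> real j powr \<delta> - 1" using j1 by (intro ln_le_minus_one) simp
  finally have "ln (real j) \<le> 1 / \<delta> * real j powr \<delta>" using \<delta>(1) by (simp add: field_simps)
  moreover have "1 \<le> real j powr \<delta>" using j1 \<delta>(1) by (simp add: ge_one_powr_ge_zero)
  ultimately have ln: "ln (real j) + 1 \<le> (1 / \<delta> + 1) * real j powr \<delta>"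
    unfolding distrib_right by linarith
  have "\<bar>v j\<bar> \<le> tail (j - 1)" by (rule coeff_le[OF j])
  also have "\<dots> \<le> C * ((ln (real j) + 1) / real j) powr (\<tau> - 1)" by (rule tail_le) (use j in simp)
  also have "\<dots> \<le> C * ((1 / \<delta> + 1) * real j powr \<delta> / real j) powr (\<tau> - 1)"
    using j1 tau C_nonneg by (intro mult_left_mono powr_mono2 divide_right_mono ln) auto
  also have "((1 / \<delta> + 1) * real j powr \<delta> / real j) powr (\<tau> - 1) =
      (1 / \<delta> + 1) powr (\<tau> - 1) * (real j powr (\<delta> - 1)) powr (\<tau> - 1)"
    using \<delta>(1) j1 by (subst powr_mult[symmetric]) (auto simp: powr_diff)
  also have "(real j powr (\<delta> - 1)) powr (\<tau> - 1) = real j powr - (\<tau> / 2)"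
    using \<delta>(3) by (simp add: powr_powr left_diff_distrib)
  finally show ?thesis by (simp only: H_def \<delta>(2) mult.assoc)
qed

lemma H_nonneg: "H \<ge> 0" using C_nonneg by (simp add: H_def)

text \<open>The first \<open>b\<^sup>2\<close> coordinates are handled by the Euclidean error bound, the others by
  the decay of \<open>v\<close>.\<close>

lemma galerkin_l1_error_le:
  assumes "\<tau> > 2" and "b \<le> N" and lnb: "ln (real b) \<ge> 1" and w0: "\<And>l. l > b \<Longrightarrow> w l = 0"
    and w: "\<And>i. i \<in> {1..b} \<Longrightarrow> (\<Sum>l=1..N. a i l * w l) = g i"
  shows "(\<Sum>j=1..N. \<bar>v j - w j\<bar>) \<le> (G + H / (\<tau> / 2 - 1)) * ln (real b) powr \<tau> * real b powr - (\<tau> - 2)"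
proof -
  have b: "b \<ge> 1" using lnb by (cases b) auto
  then have bb: "b \<le> b\<^sup>2" by (simp add: power2_eq_square)
  define A where "A = {1..min (b\<^sup>2) N}"
  have "{1..N} = A \<union> {b\<^sup>2<..N}" by (auto simp: A_def)
  then have "(\<Sum>j=1..N. \<bar>v j - w j\<bar>) = (\<Sum>j\<in>A. \<bar>v j - w j\<bar>) + (\<Sum>j\<in>{b\<^sup>2<..N}. \<bar>v j - w j\<bar>)"
    by (simp only:) (rule sum.union_disjoint; auto simp: A_def)
  also have "\<dots> \<le> G * (ln (real b) powr (\<tau> - 1) * real b powr - (\<tau> - 2)) +
      H / (\<tau> / 2 - 1) * real b powr - (\<tau> - 2)"
  proof (rule add_mono)
    \<comment> \<open>Cauchy-Schwarz against the constant 1 costs the square root of the number of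
      indices, which is at most \<open>b\<close>.\<close>
    have "(\<Sum>j\<in>A. \<bar>v j - w j\<bar>) = (\<Sum>j\<in>A. \<bar>v j - w j\<bar> * \<bar>1\<bar>)" by simp
    also have "\<dots> \<le> L2_set (\<lambda>j. v j - w j) A * L2_set (\<lambda>_. 1) A"
      by (rule L2_set_mult_ineq)
    also have "\<dots> \<le> L2_set (\<lambda>j. v j - w j) {1..N} * real b"
    proof (rule mult_mono)
      show "L2_set (\<lambda>j. v j - w j) A \<le> L2_set (\<lambda>j. v j - w j) {1..N}"
        unfolding L2_set_def A_def by (intro real_sqrt_le_mono sum_mono2) auto
      have "sqrt (real (card A)) \<le> sqrt ((real b)\<^sup>2)"
        unfolding A_def by (intro real_sqrt_le_mono) (simp flip: of_nat_power)
      then show "L2_set (\<lambda>_. 1) A \<le> real b" by (simp add: L2_set_constant)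
    qed auto
    also have "\<dots> \<le> (G * ln (real b) powr (\<tau> - 1) * real b powr - (\<tau> - 1)) * real b"
      by (intro mult_right_mono galerkin_error_le) (use assms in auto)
    also have "\<dots> = G * (ln (real b) powr (\<tau> - 1) * (real b powr - (\<tau> - 1) * real b powr 1))"
      using b by simp
    also have "real b powr - (\<tau> - 1) * real b powr 1 = real b powr - (\<tau> - 2)"
      unfolding powr_add[symmetric] by simp
    finally show "(\<Sum>j\<in>A. \<bar>v j - w j\<bar>) \<le> G * (ln (real b) powr (\<tau> - 1) * real b powr - (\<tau> - 2))" .
    have "(\<Sum>j\<in>{b\<^sup>2<..N}. \<bar>v j - w j\<bar>) \<le> (\<Sum>j\<in>{b\<^sup>2<..N}. H * real j powr - (\<tau> / 2))"
    proof (rule sum_mono)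
      fix j assume j: "j \<in> {b\<^sup>2<..N}"
      then have "w j = 0" using bb by (intro w0) simp
      then show "\<bar>v j - w j\<bar> \<le> H * real j powr - (\<tau> / 2)"
        using coeff_le_powr[OF \<open>\<tau> > 2\<close>, of j] j by simp
    qed
    also have "\<dots> = H * (\<Sum>r\<in>{b\<^sup>2..<N}. real (r + 1) powr - (\<tau> / 2))"
      unfolding sum_distrib_left
      by (rule sum.reindex_bij_witness[of _ "\<lambda>r. r + 1" "\<lambda>j. j - 1"]) auto
    also have "\<dots> \<le> H * (real (b\<^sup>2) powr (1 - \<tau> / 2) / (\<tau> / 2 - 1))"
      using H_nonneg \<open>\<tau> > 2\<close> b by (intro mult_left_mono sum_powr_tail_le) auto
    \<comment> \<open>The sum beyond \<open>b\<^sup>2\<close> is of the order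
      \<open>b powr (2 - \<tau>)\<close>, which matches the first part up to logarithms; this is the
      reason for the cutoff \<open>b\<^sup>2\<close>.\<close>
    also have "real (b\<^sup>2) powr (1 - \<tau> / 2) = real b powr - (\<tau> - 2)"
    proof -
      have "real (b\<^sup>2) = real b powr 2" using b by (simp add: powr_numeral)
      then show ?thesis by (simp only: powr_powr) (simp add: algebra_simps)
    qed
    finally show "(\<Sum>j\<in>{b\<^sup>2<..N}. \<bar>v j - w j\<bar>) \<le> H / (\<tau> / 2 - 1) * real b powr - (\<tau> - 2)"
      by simp
  qed
  also have "\<dots> \<le> G * (ln (real b) powr \<tau> * real b powr - (\<tau> - 2)) +
      H / (\<tau> / 2 - 1) * (ln (real b) powr \<tau> * real b powr - (\<tau> - 2))"
  proof (intro add_mono mult_left_mono mult_right_mono)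
    show "ln (real b) powr (\<tau> - 1) \<le> ln (real b) powr \<tau>"
      using lnb by (intro powr_mono) auto
    have "1 \<le> ln (real b) powr \<tau>"
      using lnb tau by (intro ge_one_powr_ge_zero) auto
    then have "1 * real b powr - (\<tau> - 2) \<le> ln (real b) powr \<tau> * real b powr - (\<tau> - 2)"
      by (intro mult_right_mono) auto
    then show "real b powr - (\<tau> - 2) \<le> ln (real b) powr \<tau> * real b powr - (\<tau> - 2)" by simp
  qed (use G_nonneg H_nonneg \<open>\<tau> > 2\<close> in auto)
  finally show ?thesis by (simp only: distrib_right mult.assoc)
qed

end

section \<open>The smallest eigenvalue as a minimum of the quadratic form\<close>

text \<open>The first-order condition at a minimum: at \<open>t = - p / (q + 1)\<close> the
  expression would be negative unless \<open>p\<close> vanishes.\<close>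

lemma linear_coeff_eq_0:
  fixes p q :: real
  assumes "\<And>t. 2 * t * p + t\<^sup>2 * q \<ge> 0"
  shows "p = 0"
proof -
  have q: "q \<ge> 0" using assms[of 1] assms[of "-1"] by simp
  define x where "x = p / (q + 1)"
  have p: "p = x * (q + 1)" using q by (simp add: x_def)
  have "0 \<le> - (x\<^sup>2 * (q + 2))"
    using assms[of "- x"] unfolding p by (simp add: algebra_simps power2_eq_square)
  then have "x = 0" using q by (simp add: mult_le_0_iff)
  then show ?thesis by (simp add: p)
qed

text \<open>Vectors are functions that vanish from \<open>n\<close> on, which makes the sphere a
  closed subset of a product of intervals and singletons, compact by Tychonoff's theorem.\<close>

lemma compact_sphere_fun:
  "compact {u :: nat \<Rightarrow> real. (\<forall>i\<ge>n. u i = 0) \<and> (\<Sum>i<n. (u i)\<^sup>2) = 1}" (is "compact ?S")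
proof -
  define K where "K i = (if i < n then {-1..1} else {0::real})" for i
  have cont: "continuous_on UNIV (\<lambda>u::nat \<Rightarrow> real. \<Sum>i<n. (u i)\<^sup>2)"
    by (intro continuous_intros continuous_on_product_coordinates)
  have "compactin (product_topology (\<lambda>i. euclidean) UNIV) (\<Pi>\<^sub>E i\<in>UNIV. K i)"
    by (subst compactin_PiE) (auto simp: K_def)
  then have "compact (\<Pi>\<^sub>E i\<in>UNIV. K i)"
    by (simp add: euclidean_product_topology)
  moreover have "closed {u :: nat \<Rightarrow> real. (\<Sum>i<n. (u i)\<^sup>2) = 1}"
    by (intro closed_Collect_eq cont continuous_on_const)
  ultimately have "compact ((\<Pi>\<^sub>E i\<in>UNIV. K i) \<inter> {u. (\<Sum>i<n. (u i)\<^sup>2) = 1})"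
    by (rule compact_Int_closed)
  also have "(\<Pi>\<^sub>E i\<in>UNIV. K i) \<inter> {u. (\<Sum>i<n. (u i)\<^sup>2) = 1} = ?S"
  proof (intro equalityI subsetI)
    fix u assume u: "u \<in> ?S"
    have "\<bar>u i\<bar> \<le> 1" if "i < n" for i
    proof -
      have "(u i)\<^sup>2 \<le> (\<Sum>i<n. (u i)\<^sup>2)"
        using that by (intro member_le_sum) auto
      then show ?thesis using u by (simp add: abs_square_le_1)
    qed
    then show "u \<in> (\<Pi>\<^sub>E i\<in>UNIV. K i) \<inter> {u. (\<Sum>i<n. (u i)\<^sup>2) = 1}"
      using u by (auto simp: K_def abs_le_iff)
  qed (auto simp: K_def PiE_def Pi_def not_less split: if_splits)
  finally show ?thesis .
qed

text \<open>A minimiser of the quadratic form on the unit sphere is an eigenvector, by the first-order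
  condition, and its eigenvalue is the minimum.\<close>

lemma Min_spectrum_le_quadratic_form:
  fixes A :: "real mat"
  assumes A: "A \<in> carrier_mat n n" and sym: "\<And>i j. i < n \<Longrightarrow> j < n \<Longrightarrow> A $$ (i, j) = A $$ (j, i)"
  shows "Min (spectrum A) * (\<Sum>i<n. (u i)\<^sup>2) \<le> (\<Sum>i<n. \<Sum>j<n. u i * A $$ (i, j) * u j)"
proof (cases "n = 0")
  case False
  define q where "q w = (\<Sum>i<n. \<Sum>j<n. w i * A $$ (i, j) * w j)" for w
  define S where "S = {u :: nat \<Rightarrow> real. (\<forall>i\<ge>n. u i = 0) \<and> (\<Sum>i<n. (u i)\<^sup>2) = 1}"
  have "(\<lambda>i. if i = 0 then 1 else 0) \<in> S"
    using False by (auto simp: S_def if_distrib[of "\<lambda>x. x\<^sup>2"] cong: if_cong)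
  moreover have "continuous_on S q"
    unfolding q_def
    by (intro continuous_intros continuous_on_subset[OF continuous_on_product_coordinates]) auto
  moreover have "compact S" unfolding S_def by (rule compact_sphere_fun)
  ultimately obtain v where v: "v \<in> S" "\<And>w. w \<in> S \<Longrightarrow> q v \<le> q w"
    using continuous_attains_inf[of S q] by blast
  \<comment> \<open>Homogeneity carries the minimum on the sphere over to all vectors.\<close>
  have min: "q v * (\<Sum>i<n. (w i)\<^sup>2) \<le> q w" for w
  proof (cases "(\<Sum>i<n. (w i)\<^sup>2) = 0")
    case True
    then have "w i = 0" if "i < n" for i
      using that by (subst (asm) sum_nonneg_eq_0_iff) auto
    then show ?thesis by (simp add: q_def)
  next
    case False
    define s where "s = sqrt (\<Sum>i<n. (w i)\<^sup>2)"
    have s: "s > 0" "s\<^sup>2 = (\<Sum>i<n. (w i)\<^sup>2)"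
      using False sum_nonneg[of "{..<n}" "\<lambda>i. (w i)\<^sup>2"] by (auto simp: s_def less_le)
    have "(\<lambda>i. if i < n then w i / s else 0) \<in> S"
      using s False by (auto simp: S_def power_divide sum_divide_distrib[symmetric])
    then have "q v \<le> q (\<lambda>i. if i < n then w i / s else 0)" by (rule v)
    also have "\<dots> = q w / s\<^sup>2"
      by (simp add: q_def sum_divide_distrib power2_eq_square)
    finally show ?thesis
      using zero_less_power[OF s(1), of 2] unfolding s(2)[symmetric] by (simp add: pos_le_divide_eq)
  qed
  \<comment> \<open>The residual of the eigenvalue equation at \<open>v\<close>. Perturbing
    \<open>v\<close> along \<open>r\<close> itself makes the linear coefficient equal to the squared
    norm of \<open>r\<close>, which must therefore vanish.\<close>
  define r where "r i = (\<Sum>j<n. A $$ (i, j) * v j) - q v * v i" for i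
  have v1: "(\<Sum>i<n. (v i)\<^sup>2) = 1" using v by (simp add: S_def)
  have "(\<Sum>i<n. (r i)\<^sup>2) = 0"
  proof (rule linear_coeff_eq_0[where q = "q r - q v * (\<Sum>i<n. (r i)\<^sup>2)"])
    fix t :: real
    have swap: "(\<Sum>i<n. \<Sum>j<n. v i * A $$ (i, j) * r j) = (\<Sum>i<n. \<Sum>j<n. r i * A $$ (i, j) * v j)"
      by (subst sum.swap) (auto intro!: sum.cong simp: sym)
    have "q (\<lambda>i. v i + t * r i) = (\<Sum>i<n. \<Sum>j<n. v i * A $$ (i, j) * v j
        + t * (v i * A $$ (i, j) * r j) + t * (r i * A $$ (i, j) * v j) + t\<^sup>2 * (r i * A $$ (i, j) * r j))"
      unfolding q_def by (intro sum.cong refl) (simp add: algebra_simps power2_eq_square)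
    also have "\<dots> = q v + t * (\<Sum>i<n. \<Sum>j<n. v i * A $$ (i, j) * r j)
        + t * (\<Sum>i<n. \<Sum>j<n. r i * A $$ (i, j) * v j) + t\<^sup>2 * q r"
      by (simp only: q_def sum.distrib sum_distrib_left)
    finally have "q (\<lambda>i. v i + t * r i) = \<dots>" .
    then have q: "q (\<lambda>i. v i + t * r i) = q v + 2 * t * (\<Sum>i<n. \<Sum>j<n. r i * A $$ (i, j) * v j) + t\<^sup>2 * q r"
      by (simp add: swap)
    have "(\<Sum>i<n. (v i + t * r i)\<^sup>2) = (\<Sum>i<n. (v i)\<^sup>2 + 2 * t * (r i * v i) + t\<^sup>2 * (r i)\<^sup>2)"
      by (intro sum.cong refl) (simp add: algebra_simps power2_eq_square)
    then have n: "(\<Sum>i<n. (v i + t * r i)\<^sup>2) = 1 + 2 * t * (\<Sum>i<n. r i * v i) + t\<^sup>2 * (\<Sum>i<n. (r i)\<^sup>2)"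
      by (simp only: v1 sum.distrib sum_distrib_left)
    have "(\<Sum>i<n. (r i)\<^sup>2) = (\<Sum>i<n. (\<Sum>j<n. r i * A $$ (i, j) * v j) - q v * (r i * v i))"
    proof (rule sum.cong[OF refl])
      fix i
      have "(r i)\<^sup>2 = r i * ((\<Sum>j<n. A $$ (i, j) * v j) - q v * v i)"
        unfolding power2_eq_square by (subst (2) r_def) simp
      then show "(r i)\<^sup>2 = (\<Sum>j<n. r i * A $$ (i, j) * v j) - q v * (r i * v i)"
        by (simp add: right_diff_distrib sum_distrib_left mult.assoc mult.left_commute)
    qed
    then have rr: "(\<Sum>i<n. (r i)\<^sup>2) = (\<Sum>i<n. \<Sum>j<n. r i * A $$ (i, j) * v j) - q v * (\<Sum>i<n. r i * v i)"
      by (simp only: sum_subtractf sum_distrib_left)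
    show "0 \<le> 2 * t * (\<Sum>i<n. (r i)\<^sup>2) + t\<^sup>2 * (q r - q v * (\<Sum>i<n. (r i)\<^sup>2))"
      using min[of "\<lambda>i. v i + t * r i"] unfolding q n unfolding rr by (simp add: algebra_simps)
  qed
  then have r0: "r i = 0" if "i < n" for i
    using that by (subst (asm) sum_nonneg_eq_0_iff) auto
  have "eigenvector A (vec n v) (q v)"
    unfolding eigenvector_def
  proof (intro conjI)
    show "vec n v \<noteq> 0\<^sub>v (dim_row A)"
    proof
      assume "vec n v = 0\<^sub>v (dim_row A)"
      then have "v i = 0" if "i < n" for i
        using that A by (metis carrier_matD(1) index_vec index_zero_vec(1))
      then show False using v1 by simp
    qed
    show "A *\<^sub>v vec n v = q v \<cdot>\<^sub>v vec n v"
      using A r0 by (intro eq_vecI) (auto simp: scalar_prod_def r_def atLeast0LessThan)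
  qed (use A in auto)
  then have "q v \<in> spectrum A" by (auto simp: spectrum_def eigenvalue_def)
  then have "Min (spectrum A) \<le> q v" using card_finite_spectrum[OF A] by (intro Min_le) auto
  then have "Min (spectrum A) * (\<Sum>i<n. (u i)\<^sup>2) \<le> q v * (\<Sum>i<n. (u i)\<^sup>2)"
    by (intro mult_right_mono sum_nonneg) auto
  also note min[of u]
  finally show ?thesis by (simp add: q_def)
qed simp

section \<open>Normal equations of the best linear prediction\<close>

lemma covariance_commute: "covariance M X Y = covariance M Y X"
  by (simp add: covariance_def mult.commute)

text \<open>Centring the variables: the centred parts give the covariances, the means give the
  square, and the cross term has expectation zero.\<close>

lemma (in prob_space) expectation_square_linear_combination:
  assumes "finite J"
    and Y: "\<And>j. j \<in> J \<Longrightarrow> Y j \<in> borel_measurable M"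
    and Y2: "\<And>j. j \<in> J \<Longrightarrow> integrable M (\<lambda>w. (Y j w)\<^sup>2)"
  shows "expectation (\<lambda>w. ((\<Sum>j\<in>J. e j * Y j w) - c)\<^sup>2) =
    (\<Sum>j\<in>J. \<Sum>l\<in>J. e j * e l * covariance M (Y j) (Y l)) + ((\<Sum>j\<in>J. e j * expectation (Y j)) - c)\<^sup>2"
proof -
  define Z where "Z j = (\<lambda>w. Y j w - expectation (Y j))" for j
  define m where "m = (\<Sum>j\<in>J. e j * expectation (Y j)) - c"
  have Y1: "integrable M (Y j)" if "j \<in> J" for j
    using square_integrable_imp_integrable[OF Y Y2] that by blast
  have Z: "Z j \<in> borel_measurable M" "integrable M (Z j)" "expectation (Z j) = 0" if "j \<in> J" for j
    using Y[OF that] Y1[OF that] by (auto simp: Z_def prob_space)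
  have Z2: "integrable M (\<lambda>w. (Z j w)\<^sup>2)" if "j \<in> J" for j
    using Y1[OF that] Y2[OF that] by (simp add: Z_def power2_diff)
  have ZZ: "integrable M (\<lambda>w. Z j w * Z l w)" if "j \<in> J" "l \<in> J" for j l
  proof (rule Bochner_Integration.integrable_bound)
    show "integrable M (\<lambda>w. (Z j w)\<^sup>2 + (Z l w)\<^sup>2)"
      using Z2 that by auto
    have "\<bar>x * y\<bar> \<le> x\<^sup>2 + y\<^sup>2" for x y :: real
      using sum_squares_bound[of "\<bar>x\<bar>" "\<bar>y\<bar>"] abs_ge_zero[of "x * y"]
      by (simp only: abs_mult power2_abs mult.assoc)
    then show "AE w in M. norm (Z j w * Z l w) \<le> norm ((Z j w)\<^sup>2 + (Z l w)\<^sup>2)"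
      by simp
  qed (use Z that in auto)
  have *: "(\<Sum>j\<in>J. e j * Y j w) - c = (\<Sum>j\<in>J. e j * Z j w) + m" for w
    by (simp add: Z_def m_def right_diff_distrib sum_subtractf)
  have sq: "((\<Sum>j\<in>J. e j * Y j w) - c)\<^sup>2 =
      (\<Sum>j\<in>J. \<Sum>l\<in>J. e j * e l * (Z j w * Z l w)) + (2 * m * (\<Sum>j\<in>J. e j * Z j w) + m\<^sup>2)" for w
  proof -
    have "(\<Sum>j\<in>J. e j * Z j w)\<^sup>2 = (\<Sum>j\<in>J. \<Sum>l\<in>J. e j * e l * (Z j w * Z l w))"
      unfolding power2_eq_square sum_product by (intro sum.cong refl) simp
    then show ?thesis unfolding * power2_sum by simp
  qed
  have "expectation (\<lambda>w. ((\<Sum>j\<in>J. e j * Y j w) - c)\<^sup>2) =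
      (\<Sum>j\<in>J. \<Sum>l\<in>J. e j * e l * expectation (\<lambda>w. Z j w * Z l w)) + m\<^sup>2"
    unfolding sq using ZZ Z by (simp add: prob_space)
  then show ?thesis
    unfolding m_def covariance_def Z_def .
qed

text \<open>The intercept enters the mean squared error only through the squared mean of the
  forecast error, so a minimiser makes that mean zero. What remains is a quadratic form in the
  coefficients, whose stationarity gives the normal equations.\<close>

lemma (in prob_space) best_linear_prediction_normal_equations:
  assumes X: "\<And>j. j \<in> {1..i} \<Longrightarrow> X j \<in> borel_measurable M"
    and X2: "\<And>j. j \<in> {1..i} \<Longrightarrow> integrable M (\<lambda>w. (X j w)\<^sup>2)"
    and "k < i" and c: "best_linear_prediction M X i k c"
  shows best_linear_prediction_intercept:
      "c 0 = expectation (X i) - (\<Sum>j=1..k. c j * expectation (X (i - j)))"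
    and best_linear_prediction_coeffs:
      "j \<in> {1..k} \<Longrightarrow> (\<Sum>l=1..k. covariance M (X (i - j)) (X (i - l)) * c l) = covariance M (X i) (X (i - j))"
proof -
  define R where "R d = expectation (\<lambda>w. (X i w - linear_forecast X i k d w)\<^sup>2)" for d
  \<comment> \<open>Coefficients of the forecast error without its intercept: 1 for the target at
    lag 0 and \<open>- d j\<close> at lag \<open>j\<close>. The entry \<open>d 0\<close> is left
    out, being the intercept.\<close>
  define e where "e d j = (if j = 0 then 1 else - d j)" for d :: "nat \<Rightarrow> real" and j :: nat
  define F where "F f = (\<Sum>j=0..k. \<Sum>l=0..k. f j * f l * covariance M (X (i - j)) (X (i - l)))"
    for f :: "nat \<Rightarrow> real"
  have split0: "(\<Sum>j=0..k. f j) = f 0 + (\<Sum>j=1..k. f j)" for f :: "nat \<Rightarrow> real"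
    by (simp add: sum.atLeast_Suc_atMost)
  have esum: "(\<Sum>j=0..k. e d j * y j) = y 0 - (\<Sum>j=1..k. d j * y j)" for d y
    by (simp add: split0 e_def sum_negf)
  have R: "R d = F (e d) + (expectation (X i) - (\<Sum>j=1..k. d j * expectation (X (i - j))) - d 0)\<^sup>2" for d
  proof -
    have "R d = expectation (\<lambda>w. ((\<Sum>j=0..k. e d j * X (i - j) w) - d 0)\<^sup>2)"
      unfolding R_def linear_forecast_def esum by (simp add: algebra_simps)
    also have "\<dots> = F (e d) + ((\<Sum>j=0..k. e d j * expectation (X (i - j))) - d 0)\<^sup>2"
      unfolding F_def
      by (rule expectation_square_linear_combination) (use X X2 \<open>k < i\<close> in auto)
    finally show ?thesis unfolding esum by simp
  qed
  have min: "R c \<le> R d" for d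
    using c by (simp add: best_linear_prediction_def is_arg_min_linorder R_def)
  define opt where "opt d = expectation (X i) - (\<Sum>j=1..k. d j * expectation (X (i - j)))" for d
  have e_upd: "e (d(0 := x)) = e d" for d x by (auto simp: e_def)
  have Ropt: "R (d(0 := opt d)) = F (e d)" for d
    by (simp add: R e_upd opt_def)
  have "(opt c - c 0)\<^sup>2 \<le> 0"
    using min[of "c(0 := opt c)"] unfolding Ropt by (simp add: R opt_def)
  then show c0: "c 0 = expectation (X i) - (\<Sum>j=1..k. c j * expectation (X (i - j)))"
    by (simp add: opt_def)
  \<comment> \<open>With optimal intercepts on both sides, minimality passes from \<open>R\<close>
    to \<open>F\<close>.\<close>
  have Fmin: "F (e c) \<le> F (e d)" for d
    using min[of "d(0 := opt d)"] unfolding Ropt by (simp add: R c0)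
  assume j: "j \<in> {1..k}"
  define r where "r l = covariance M (X (i - j)) (X (i - l))" for l
  have r': "covariance M (X (i - p)) (X (i - j)) = r p" for p
    unfolding r_def by (rule covariance_commute)
  have delta: "(\<Sum>l=0..k. of_bool (l = j) * f l) = f j" for f :: "nat \<Rightarrow> real"
  proof -
    have "(\<Sum>l=0..k. of_bool (l = j) * f l) = (\<Sum>l\<in>{j}. of_bool (l = j) * f l)"
      using j by (intro sum.mono_neutral_right) auto
    then show ?thesis by simp
  qed
  \<comment> \<open>First-order condition for moving the coefficient of lag \<open>j\<close>
    alone.\<close>
  have "- (\<Sum>l=0..k. e c l * r l) = 0"
  proof (rule linear_coeff_eq_0[where q = "r j"])
    fix t :: real
    have "e (c(j := c j + t)) = (\<lambda>l. e c l - t * of_bool (l = j))"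
      using j by (auto simp: e_def)
    then have "F (e (c(j := c j + t))) = (\<Sum>p=0..k. \<Sum>l=0..k.
        e c p * e c l * covariance M (X (i - p)) (X (i - l))
        - t * (of_bool (l = j) * (e c p * covariance M (X (i - p)) (X (i - l))))
        - t * (of_bool (p = j) * (e c l * covariance M (X (i - p)) (X (i - l))))
        + t\<^sup>2 * (of_bool (p = j) * (of_bool (l = j) * covariance M (X (i - p)) (X (i - l)))))"
      unfolding F_def by (intro sum.cong refl) (simp add: algebra_simps power2_eq_square)
    also have "\<dots> = F (e c) - t * (\<Sum>p=0..k. \<Sum>l=0..k. of_bool (l = j) * (e c p * covariance M (X (i - p)) (X (i - l))))
        - t * (\<Sum>p=0..k. of_bool (p = j) * (\<Sum>l=0..k. e c l * covariance M (X (i - p)) (X (i - l))))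
        + t\<^sup>2 * (\<Sum>p=0..k. of_bool (p = j) * (\<Sum>l=0..k. of_bool (l = j) * covariance M (X (i - p)) (X (i - l))))"
      unfolding F_def by (simp only: sum.distrib sum_subtractf sum_distrib_left)
    also have "\<dots> = F (e c) - t * (\<Sum>p=0..k. e c p * r p) - t * (\<Sum>l=0..k. e c l * r l) + t\<^sup>2 * r j"
      by (simp only: delta r_def[symmetric] r')
    finally show "0 \<le> 2 * t * - (\<Sum>l=0..k. e c l * r l) + t\<^sup>2 * r j"
      using Fmin[of "c(j := c j + t)"] by simp
  qed
  then have "r 0 - (\<Sum>l=1..k. c l * r l) = 0" unfolding esum by simp
  then show "(\<Sum>l=1..k. covariance M (X (i - j)) (X (i - l)) * c l) = covariance M (X i) (X (i - j))"
    by (simp add: r_def covariance_commute[of M "X i"] mult.commute)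
qed

section \<open>From the hypotheses on the array to decaying systems\<close>

lemma short_range_dependent_covariance_bound:
  assumes "short_range_dependent M x \<tau>" and "\<And>n. prob_space (M n)" and "\<tau> > 0"
  obtains D where "D > 0"
    and "\<And>n j l. j \<in> {1..n} \<Longrightarrow> l \<in> {1..n} \<Longrightarrow>
      \<bar>covariance (M n) (x n j) (x n l)\<bar> \<le> D * real ((j - l) + (l - j) + 1) powr - \<tau>"
proof -
  obtain C K where C: "C > 0"
    "\<And>n k r. k \<in> {1..n} \<Longrightarrow> r \<in> {- int k + 1..int n - int k} \<Longrightarrow> r \<noteq> 0 \<Longrightarrow>
        \<bar>covariance (M n) (x n k) (x n (nat (int k + r)))\<bar> \<le> C * real_of_int \<bar>r\<bar> powr (- \<tau>)"
    and K: "\<And>n i. i \<in> {1..n} \<Longrightarrow> prob_space.variance (M n) (x n i) \<le> K"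
    using assms(1) unfolding short_range_dependent_def by metis
  \<comment> \<open>\<open>2 powr \<tau>\<close> pays for shifting the distance by one, which lets
    the same bound cover the diagonal; \<open>\<bar>K\<bar>\<close> bounds the variances
    there.\<close>
  define D where "D = C * 2 powr \<tau> + \<bar>K\<bar>"
  have "D > 0" using C(1) by (simp add: D_def add_pos_nonneg)
  moreover have "\<bar>covariance (M n) (x n j) (x n l)\<bar> \<le> D * real ((j - l) + (l - j) + 1) powr - \<tau>"
    if j: "j \<in> {1..n}" and l: "l \<in> {1..n}" for n j l
  proof (cases "j = l")
    case True
    interpret prob_space "M n" by (rule assms(2))
    have cov: "covariance (M n) (x n l) (x n l) = variance (x n l)"
      by (simp add: covariance_def power2_eq_square)
    then have "\<bar>covariance (M n) (x n l) (x n l)\<bar> \<le> \<bar>K\<bar>"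
      using K[OF l] variance_positive[of "x n l"] by simp
    then have "\<bar>covariance (M n) (x n l) (x n l)\<bar> \<le> D"
      using C(1) by (simp add: D_def add_increasing)
    then show ?thesis using True by simp
  next
    case False
    define d where "d = (j - l) + (l - j)"
    have d: "real d \<ge> 1" "real_of_int \<bar>int l - int j\<bar> = real d"
      using False by (auto simp: d_def)
    have "\<bar>covariance (M n) (x n j) (x n (nat (int j + (int l - int j))))\<bar>
        \<le> C * real_of_int \<bar>int l - int j\<bar> powr (- \<tau>)"
      by (rule C(2)) (use j l False in auto)
    then have "\<bar>covariance (M n) (x n j) (x n l)\<bar> \<le> C * real d powr - \<tau>"
      unfolding d(2) by simp
    also have "real d powr - \<tau> \<le> (real (d + 1) / 2) powr - \<tau>"
      using d(1) \<open>\<tau> > 0\<close> by (intro powr_mono2') auto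
    also have "(real (d + 1) / 2) powr - \<tau> = 2 powr \<tau> * real (d + 1) powr - \<tau>"
      by (simp add: powr_divide powr_minus_divide)
    also have "C * (2 powr \<tau> * real (d + 1) powr - \<tau>) \<le> D * real (d + 1) powr - \<tau>"
      unfolding mult.assoc[symmetric] by (rule mult_right_mono) (auto simp: D_def)
    finally show ?thesis using C(1) by (simp add: d_def)
  qed
  ultimately show ?thesis by (rule that)
qed

text \<open>The predictors of \<open>X i\<close> give a principal submatrix of the covariance
  matrix, in reversed order; padding with zeros turns its quadratic form into that of the full
  matrix.\<close>

lemma covariance_matrix_coercive:
  assumes "\<kappa> \<le> Min (spectrum (covariance_matrix M X n))" and "i \<in> {1..n}"
  shows "\<kappa> * (\<Sum>j=1..i - 1. (u j)\<^sup>2) \<le>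
    (\<Sum>j=1..i - 1. u j * (\<Sum>l=1..i - 1. covariance M (X (i - j)) (X (i - l)) * u l))"
proof -
  define A where "A = covariance_matrix M X n"
  define N where "N = i - 1"
  \<comment> \<open>Matrix position \<open>p\<close> belongs to \<open>X (p + 1)\<close>, which is
    the predictor of \<open>X i\<close> at lag \<open>N - p\<close>.\<close>
  define w where "w p = (if p < N then u (N - p) else 0)" for p
  have N: "N \<le> n" "i = Suc N" using assms(2) by (auto simp: N_def)
  have A: "A \<in> carrier_mat n n" by (simp add: A_def covariance_matrix_def)
  have Aij: "A $$ (p, q) = covariance M (X (Suc p)) (X (Suc q))" if "p < n" "q < n" for p q
    using that by (simp add: A_def covariance_matrix_def)
  have rev: "(\<Sum>p<N. f (N - p)) = (\<Sum>j=1..N. f j)" for f :: "nat \<Rightarrow> real"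
    by (rule sum.reindex_bij_witness[of _ "\<lambda>j. N - j" "\<lambda>p. N - p"]) auto
  have restrict: "(\<Sum>p<n. w p * f p) = (\<Sum>j=1..N. u j * f (N - j))" for f
  proof -
    have "(\<Sum>p<n. w p * f p) = (\<Sum>p<N. u (N - p) * f (N - (N - p)))"
      by (rule sum.mono_neutral_cong_right) (use N in \<open>auto simp: w_def\<close>)
    then show ?thesis using rev[of "\<lambda>j. u j * f (N - j)"] by simp
  qed
  have "(\<Sum>p<n. (w p)\<^sup>2) = (\<Sum>j=1..N. u j * w (N - j))"
    unfolding power2_eq_square by (rule restrict)
  also have "\<dots> = (\<Sum>j=1..N. (u j)\<^sup>2)"
    by (intro sum.cong) (auto simp: w_def power2_eq_square)
  finally have sq: "(\<Sum>p<n. (w p)\<^sup>2) = (\<Sum>j=1..N. (u j)\<^sup>2)" .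
  have "\<kappa> * (\<Sum>p<n. (w p)\<^sup>2) \<le> Min (spectrum A) * (\<Sum>p<n. (w p)\<^sup>2)"
    using assms(1) by (intro mult_right_mono sum_nonneg) (auto simp: A_def)
  also have "\<dots> \<le> (\<Sum>p<n. \<Sum>q<n. w p * A $$ (p, q) * w q)"
    by (rule Min_spectrum_le_quadratic_form[OF A]) (simp add: Aij covariance_commute)
  also have "\<dots> = (\<Sum>p<n. w p * (\<Sum>q<n. w q * A $$ (p, q)))"
    by (simp add: sum_distrib_left mult.assoc mult.commute mult.left_commute)
  also have "\<dots> = (\<Sum>j=1..N. u j * (\<Sum>l=1..N. u l * A $$ (N - j, N - l)))"
    by (simp only: restrict)
  also have "\<dots> = (\<Sum>j=1..N. u j * (\<Sum>l=1..N. covariance M (X (i - j)) (X (i - l)) * u l))"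
  proof (rule sum.cong[OF refl], rule arg_cong[OF sum.cong[OF refl]])
    fix j l assume "j \<in> {1..N}" "l \<in> {1..N}"
    then have *: "N - j < n" "N - l < n" "Suc (N - j) = i - j" "Suc (N - l) = i - l"
      using N by auto
    show "u l * A $$ (N - j, N - l) = covariance M (X (i - j)) (X (i - l)) * u l"
      unfolding Aij[OF *(1,2)] *(3,4) by simp
  qed
  finally show ?thesis unfolding sq N_def .
qed

text \<open>Lags \<open>j\<close> and \<open>l\<close> are as far apart as the variables
  \<open>X (i - j)\<close> and \<open>X (i - l)\<close>, and the target has lag 0, so the covariance
  bound carries over. Coercivity comes from the spectrum, the equations from the optimality of
  \<open>c\<close>.\<close>

lemma prediction_decaying_system:
  assumes "prob_space M"
    and X: "\<And>j. j \<in> {1..n} \<Longrightarrow> X j \<in> borel_measurable M"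
    and X2: "\<And>j. j \<in> {1..n} \<Longrightarrow> integrable M (\<lambda>w. (X j w)\<^sup>2)"
    and decay: "\<And>j l. j \<in> {1..n} \<Longrightarrow> l \<in> {1..n} \<Longrightarrow>
      \<bar>covariance M (X j) (X l)\<bar> \<le> D * real ((j - l) + (l - j) + 1) powr - \<tau>"
    and "\<tau> > 1" "0 < \<kappa>" "\<kappa> \<le> D"
    and \<kappa>: "\<kappa> \<le> Min (spectrum (covariance_matrix M X n))"
    and i: "i \<in> {1..n}" and c: "best_linear_prediction M X i (i - 1) c"
  shows "decaying_system \<tau> D \<kappa> (i - 1) (\<lambda>j l. covariance M (X (i - j)) (X (i - l)))
    (\<lambda>j. covariance M (X i) (X (i - j))) c"
proof
  show "\<bar>covariance M (X (i - j)) (X (i - l))\<bar> \<le> D * real ((j - l) + (l - j) + 1) powr - \<tau>"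
    if "j \<in> {1..i - 1}" "l \<in> {1..i - 1}" for j l
  proof -
    have "(i - j) - (i - l) + ((i - l) - (i - j)) = (j - l) + (l - j)"
      using that by auto
    moreover have "i - j \<in> {1..n}" "i - l \<in> {1..n}" using that i by auto
    ultimately show ?thesis using decay by metis
  qed
  show "\<bar>covariance M (X i) (X (i - j))\<bar> \<le> D * real (j + 1) powr - \<tau>"
    if "j \<in> {1..i - 1}" for j
  proof -
    have "i - (i - j) + (i - j - i) = j" using that by auto
    moreover have "i - j \<in> {1..n}" using that i by auto
    ultimately show ?thesis using decay i by metis
  qed
  show "\<kappa> * (\<Sum>j=1..i - 1. (u j)\<^sup>2) \<le>
    (\<Sum>j=1..i - 1. u j * (\<Sum>l=1..i - 1. covariance M (X (i - j)) (X (i - l)) * u l))" for u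
    by (rule covariance_matrix_coercive[OF \<kappa> i])
  show "(\<Sum>l=1..i - 1. covariance M (X (i - j)) (X (i - l)) * c l) = covariance M (X i) (X (i - j))"
    if "j \<in> {1..i - 1}" for j
    by (rule prob_space.best_linear_prediction_coeffs[OF assms(1)])
      (use X X2 i c that in auto)
qed fact+

text \<open>Padded with zeros, \<open>d\<close> solves the first \<open>b\<close> equations of the
  full system, so it is the Galerkin approximation of \<open>c\<close>. The difference of the
  intercepts is a sum of coefficient errors times means, hence at most \<open>K\<close> times the
  absolute sum of the errors.\<close>

lemma prediction_approximation:
  assumes "prob_space M" and "decaying_system \<tau> D \<kappa> (i - 1) (\<lambda>j l. covariance M (X (i - j)) (X (i - l)))
      (\<lambda>j. covariance M (X i) (X (i - j))) c"
    and X: "\<And>j. j \<in> {1..i} \<Longrightarrow> X j \<in> borel_measurable M"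
    and X2: "\<And>j. j \<in> {1..i} \<Longrightarrow> integrable M (\<lambda>w. (X j w)\<^sup>2)"
    and K: "\<And>j. j \<in> {1..i} \<Longrightarrow> prob_space.expectation M (\<lambda>w. \<bar>X j w\<bar>) \<le> K"
    and b: "b < i" "ln (real b) \<ge> 1" and "\<tau> > 2"
    and c: "best_linear_prediction M X i (i - 1) c"
    and d: "best_linear_prediction M X i b d"
  shows "L2_set (\<lambda>j. c j - (if j \<le> b then d j else 0)) {1..i - 1}
      \<le> decaying_system.G \<tau> D \<kappa> * ln (real b) powr (\<tau> - 1) * real b powr - (\<tau> - 1)" (is ?l2)
    and "\<bar>c 0 - d 0\<bar> \<le> K * (decaying_system.G \<tau> D \<kappa> + decaying_system.H \<tau> D \<kappa> / (\<tau> / 2 - 1))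
      * ln (real b) powr \<tau> * real b powr - (\<tau> - 2)" (is ?intercept)
proof -
  interpret prob_space M by fact
  interpret decaying_system \<tau> D \<kappa> "i - 1" "\<lambda>j l. covariance M (X (i - j)) (X (i - l))"
    "\<lambda>j. covariance M (X i) (X (i - j))" c by fact
  define w where "w j = (if j \<le> b then d j else 0)" for j
  have bi: "b \<le> i - 1" "1 \<le> i" using b by auto
  have restrict: "(\<Sum>l=1..i - 1. f l * w l) = (\<Sum>l=1..b. f l * d l)" for f
    by (rule sum.mono_neutral_cong_right) (use bi in \<open>auto simp: w_def\<close>)
  have w: "(\<Sum>l=1..i - 1. covariance M (X (i - j)) (X (i - l)) * w l) = covariance M (X i) (X (i - j))"
    if "j \<in> {1..b}" for j
    unfolding restrict by (rule best_linear_prediction_coeffs) (use X X2 b d that in auto)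
  have w0: "w l = 0" if "l > b" for l using that by (simp add: w_def)
  show ?l2 using galerkin_error_le[OF bi(1) b(2) w0 w] unfolding w_def .
  have EX: "\<bar>expectation (X (i - j))\<bar> \<le> K" if "j \<in> {1..i - 1}" for j
  proof -
    have "i - j \<in> {1..i}" using that by auto
    then show ?thesis using K integral_abs_bound[of M "X (i - j)"] by (meson order_trans)
  qed
  have "c 0 = expectation (X i) - (\<Sum>j=1..i - 1. c j * expectation (X (i - j)))"
    by (rule best_linear_prediction_intercept) (use X X2 bi c in auto)
  moreover have "d 0 = expectation (X i) - (\<Sum>j=1..b. d j * expectation (X (i - j)))"
    by (rule best_linear_prediction_intercept) (use X X2 b d in auto)
  moreover have "(\<Sum>j=1..b. d j * expectation (X (i - j))) = (\<Sum>j=1..i - 1. w j * expectation (X (i - j)))"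
    using restrict[of "\<lambda>j. expectation (X (i - j))"] by (simp add: mult.commute)
  ultimately have "c 0 - d 0 = (\<Sum>j=1..i - 1. w j * expectation (X (i - j))) - (\<Sum>j=1..i - 1. c j * expectation (X (i - j)))"
    by simp
  then have "\<bar>c 0 - d 0\<bar> = \<bar>\<Sum>j=1..i - 1. (c j - w j) * expectation (X (i - j))\<bar>"
    by (simp add: left_diff_distrib sum_subtractf abs_minus_commute)
  also have "\<dots> \<le> (\<Sum>j=1..i - 1. \<bar>(c j - w j) * expectation (X (i - j))\<bar>)"
    by (rule sum_abs)
  also have "\<dots> \<le> (\<Sum>j=1..i - 1. K * \<bar>c j - w j\<bar>)"
    unfolding abs_mult mult.commute[of K] by (intro sum_mono mult_left_mono EX) auto
  also have "\<dots> = K * (\<Sum>j=1..i - 1. \<bar>c j - w j\<bar>)"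
    by (rule sum_distrib_left[symmetric])
  also have "\<dots> \<le> K * ((G + H / (\<tau> / 2 - 1)) * ln (real b) powr \<tau> * real b powr - (\<tau> - 2))"
  proof (rule mult_left_mono)
    show "0 \<le> K" by (rule order_trans[OF _ K[of 1]]) (use bi in auto)
  qed (rule galerkin_l1_error_le[OF \<open>\<tau> > 2\<close> bi(1) b(2) w0 w])
  finally show ?intercept by (simp only: mult.assoc)
qed

section \<open>Uniform bounds for the array\<close>

theorem theorem2p4:
  fixes M :: "nat \<Rightarrow> 'a measure"
    and x :: "nat \<Rightarrow> nat \<Rightarrow> 'a \<Rightarrow> real"
    and \<tau> :: real
    and \<phi> :: "nat \<Rightarrow> nat \<Rightarrow> nat \<Rightarrow> real"
  assumes "triangular_array M x"
    and "\<tau> > 1"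
    and "UPDC M x"
    and "short_range_dependent M x \<tau>"
    and "\<And>n i. i \<in> {1..n} \<Longrightarrow> best_linear_prediction (M n) (x n) i (i - 1) (\<phi> n i)"
  shows "(\<exists>C>0. \<forall>\<^sub>F n in sequentially. \<forall>j\<in>{1..<n}.
            (MAX i\<in>{j<..n}. \<bar>\<phi> n i j\<bar>) \<le> C * ((ln (real j) + 1) / real j) powr (\<tau> - 1)) \<and>
         (\<forall>(b :: nat \<Rightarrow> nat) (\<phi>b :: nat \<Rightarrow> nat \<Rightarrow> nat \<Rightarrow> real).
            \<tau> > 2 \<longrightarrow>
            filterlim b at_top sequentially \<longrightarrow>
            (\<forall>\<^sub>F n in sequentially. 0 < b n \<and> b n < n) \<longrightarrow>
            (\<forall>n. \<forall>i\<in>{b n<..n}. best_linear_prediction (M n) (x n) i (b n) (\<phi>b n i)) \<longrightarrow>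
            (\<exists>C>0. \<forall>\<^sub>F n in sequentially.
               (MAX i\<in>{b n<..n}.
                  L2_set (\<lambda>j. \<phi> n i j - (if j \<le> b n then \<phi>b n i j else 0)) {1..i - 1})
                 \<le> C * ln (real (b n)) powr (\<tau> - 1) * real (b n) powr (- (\<tau> - 1)) \<and>
               (MAX i\<in>{b n<..n}. \<bar>\<phi> n i 0 - \<phi>b n i 0\<bar>)
                 \<le> C * ln (real (b n)) powr \<tau> * real (b n) powr (- (\<tau> - 2))))"
proof -
  have prob: "prob_space (M n)" for n
    using assms(1) by (simp add: triangular_array_def)
  have X: "x n j \<in> borel_measurable (M n)" if "j \<in> {1..n}" for n j
    using assms(1) that by (simp add: triangular_array_def)
  have X2: "integrable (M n) (\<lambda>w. (x n j w)\<^sup>2)" if "j \<in> {1..n}" for n j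
    using assms(4) that by (auto simp: short_range_dependent_def)
  obtain K where K: "\<And>n i. i \<in> {1..n} \<Longrightarrow> prob_space.expectation (M n) (\<lambda>w. \<bar>x n i w\<bar>) \<le> K"
    using assms(4) unfolding short_range_dependent_def by metis
  obtain \<kappa> where \<kappa>: "\<kappa> > 0"
    "\<forall>\<^sub>F n in sequentially. \<kappa> \<le> Min (spectrum (covariance_matrix (M n) (x n) n))"
    using assms(3) unfolding UPDC_def by blast
  obtain D0 where D0: "D0 > 0" "\<And>n j l. j \<in> {1..n} \<Longrightarrow> l \<in> {1..n} \<Longrightarrow>
      \<bar>covariance (M n) (x n j) (x n l)\<bar> \<le> D0 * real ((j - l) + (l - j) + 1) powr - \<tau>"
    using short_range_dependent_covariance_bound[OF assms(4) prob] \<open>\<tau> > 1\<close> by auto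
  \<comment> \<open>Adding \<open>\<kappa>\<close> secures \<open>\<kappa> \<le> D\<close>, as the
    locale demands.\<close>
  define D where "D = D0 + \<kappa>"
  have decay: "\<bar>covariance (M n) (x n j) (x n l)\<bar> \<le> D * real ((j - l) + (l - j) + 1) powr - \<tau>"
    if "j \<in> {1..n}" "l \<in> {1..n}" for n j l
    by (rule order_trans[OF D0(2)[OF that] mult_right_mono]) (use \<kappa> in \<open>auto simp: D_def\<close>)
  have "\<kappa> \<le> D" using D0 by (simp add: D_def)
  let ?sys = "\<lambda>n i. decaying_system \<tau> D \<kappa> (i - 1) (\<lambda>j l. covariance (M n) (x n (i - j)) (x n (i - l)))
    (\<lambda>j. covariance (M n) (x n i) (x n (i - j))) (\<phi> n i)"
  have sys: "\<forall>\<^sub>F n in sequentially. \<forall>i\<in>{1..n}. ?sys n i"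
    using \<kappa>(2)
  proof eventually_elim
    case (elim n)
    show ?case
      using prediction_decaying_system[OF prob X X2 decay \<open>\<tau> > 1\<close> \<open>\<kappa> > 0\<close> \<open>\<kappa> \<le> D\<close> elim _ assms(5)]
      by blast
  qed
  show ?thesis
  proof (intro conjI allI impI)
    \<comment> \<open>Nonnegativity of the constant is proved only inside the locale, hence the
      absolute value; adding 1 makes \<open>C0\<close> positive.\<close>
    define C0 where "C0 = \<bar>decaying_system.C \<tau> D \<kappa>\<bar> + 1"
    have "\<forall>\<^sub>F n in sequentially. \<forall>j\<in>{1..<n}.
        (MAX i\<in>{j<..n}. \<bar>\<phi> n i j\<bar>) \<le> C0 * ((ln (real j) + 1) / real j) powr (\<tau> - 1)"
      using sys
    proof eventually_elim
      case (elim n)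
      have "\<bar>\<phi> n i j\<bar> \<le> C0 * ((ln (real j) + 1) / real j) powr (\<tau> - 1)"
        if "j \<in> {1..<n}" "i \<in> {j<..n}" for i j
      proof -
        interpret decaying_system \<tau> D \<kappa> "i - 1" "\<lambda>j l. covariance (M n) (x n (i - j)) (x n (i - l))"
          "\<lambda>j. covariance (M n) (x n i) (x n (i - j))" "\<phi> n i"
          using elim that by auto
        have "\<bar>\<phi> n i j\<bar> \<le> tail (j - 1)" by (rule coeff_le) (use that in auto)
        also have "\<dots> \<le> decaying_system.C \<tau> D \<kappa> * ((ln (real j) + 1) / real j) powr (\<tau> - 1)"
          by (rule tail_le) (use that in auto)
        also have "\<dots> \<le> C0 * ((ln (real j) + 1) / real j) powr (\<tau> - 1)"
          by (intro mult_right_mono) (auto simp: C0_def)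
        finally show ?thesis .
      qed
      \<comment> \<open>\<open>j < n\<close> makes the set under \<open>MAX\<close>
        nonempty.\<close>
      then show ?case by (auto intro!: Max.boundedI)
    qed
    moreover have "C0 > 0" by (simp add: C0_def)
    ultimately show "\<exists>C>0. \<forall>\<^sub>F n in sequentially. \<forall>j\<in>{1..<n}.
        (MAX i\<in>{j<..n}. \<bar>\<phi> n i j\<bar>) \<le> C * ((ln (real j) + 1) / real j) powr (\<tau> - 1)" by blast
  next
    fix b :: "nat \<Rightarrow> nat" and \<phi>b :: "nat \<Rightarrow> nat \<Rightarrow> nat \<Rightarrow> real"
    assume "\<tau> > 2" and b: "filterlim b at_top sequentially"
      and bn: "\<forall>\<^sub>F n in sequentially. 0 < b n \<and> b n < n"
      and \<phi>b: "\<forall>n. \<forall>i\<in>{b n<..n}. best_linear_prediction (M n) (x n) i (b n) (\<phi>b n i)"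
    define C1 where "C1 = decaying_system.G \<tau> D \<kappa>"
    define C2 where "C2 = K * (decaying_system.G \<tau> D \<kappa> + decaying_system.H \<tau> D \<kappa> / (\<tau> / 2 - 1))"
    define C where "C = \<bar>C1\<bar> + \<bar>C2\<bar> + 1"
    \<comment> \<open>Since \<open>exp 1 \<le> 3\<close>, this makes the logarithm of
      \<open>b n\<close> at least 1.\<close>
    have "\<forall>\<^sub>F n in sequentially. 3 \<le> b n"
      using b by (simp add: filterlim_at_top)
    with sys bn have "\<forall>\<^sub>F n in sequentially.
        (MAX i\<in>{b n<..n}. L2_set (\<lambda>j. \<phi> n i j - (if j \<le> b n then \<phi>b n i j else 0)) {1..i - 1})
          \<le> C * ln (real (b n)) powr (\<tau> - 1) * real (b n) powr (- (\<tau> - 1)) \<and>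
        (MAX i\<in>{b n<..n}. \<bar>\<phi> n i 0 - \<phi>b n i 0\<bar>)
          \<le> C * ln (real (b n)) powr \<tau> * real (b n) powr (- (\<tau> - 2))"
    proof eventually_elim
      case (elim n)
      have "exp 1 \<le> real (b n)" using elim(3) exp_le by linarith
      then have lnb: "ln (real (b n)) \<ge> 1" using elim(3) by (simp add: ln_ge_iff)
      have "L2_set (\<lambda>j. \<phi> n i j - (if j \<le> b n then \<phi>b n i j else 0)) {1..i - 1}
          \<le> C * ln (real (b n)) powr (\<tau> - 1) * real (b n) powr (- (\<tau> - 1)) \<and>
        \<bar>\<phi> n i 0 - \<phi>b n i 0\<bar> \<le> C * ln (real (b n)) powr \<tau> * real (b n) powr (- (\<tau> - 2))"
        if i: "i \<in> {b n<..n}" for i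
      proof
        have "?sys n i" using elim i by auto
        note approx = prediction_approximation[OF prob this _ _ _ _ lnb \<open>\<tau> > 2\<close>, where K = K and d = "\<phi>b n i"]
        have "L2_set (\<lambda>j. \<phi> n i j - (if j \<le> b n then \<phi>b n i j else 0)) {1..i - 1}
          \<le> C1 * ln (real (b n)) powr (\<tau> - 1) * real (b n) powr (- (\<tau> - 1))"
          unfolding C1_def by (rule approx(1)) (use X X2 K i \<phi>b assms(5) in auto)
        also have "\<dots> \<le> C * ln (real (b n)) powr (\<tau> - 1) * real (b n) powr (- (\<tau> - 1))"
          by (intro mult_right_mono) (auto simp: C_def)
        finally show "L2_set (\<lambda>j. \<phi> n i j - (if j \<le> b n then \<phi>b n i j else 0)) {1..i - 1}
          \<le> C * ln (real (b n)) powr (\<tau> - 1) * real (b n) powr (- (\<tau> - 1))" .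
        have "\<bar>\<phi> n i 0 - \<phi>b n i 0\<bar> \<le> C2 * ln (real (b n)) powr \<tau> * real (b n) powr (- (\<tau> - 2))"
          unfolding C2_def by (rule approx(2)) (use X X2 K i \<phi>b assms(5) in auto)
        also have "\<dots> \<le> C * ln (real (b n)) powr \<tau> * real (b n) powr (- (\<tau> - 2))"
          by (intro mult_right_mono) (auto simp: C_def)
        finally show "\<bar>\<phi> n i 0 - \<phi>b n i 0\<bar> \<le> C * ln (real (b n)) powr \<tau> * real (b n) powr (- (\<tau> - 2))" .
      qed
      moreover have "{b n<..n} \<noteq> {}" using elim(2) by auto
      ultimately show ?case by (auto intro!: Max.boundedI)
    qed
    moreover have "C > 0" by (simp add: C_def)
    ultimately show "\<exists>C>0. \<forall>\<^sub>F n in sequentially.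
               (MAX i\<in>{b n<..n}.
                  L2_set (\<lambda>j. \<phi> n i j - (if j \<le> b n then \<phi>b n i j else 0)) {1..i - 1})
                 \<le> C * ln (real (b n)) powr (\<tau> - 1) * real (b n) powr (- (\<tau> - 1)) \<and>
               (MAX i\<in>{b n<..n}. \<bar>\<phi> n i 0 - \<phi>b n i 0\<bar>)
                 \<le> C * ln (real (b n)) powr \<tau> * real (b n) powr (- (\<tau> - 2))" by blast
  qed
qed

end
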